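(* Let $d\in\mathbb{N}$, let $p:\mathbb{Z}^d\to[0,1)$ satisfy $\sum_x p(x)=1$, $p(x)=0$ for $|x|>M$ for some $M<\infty$, and strong aperiodicity (for every $u\in\mathbb{Z}^d$ the smallest additive subgroup of $\mathbb{Z}^d$ containing $\{u+x:p(x)>0\}$ is $\mathbb{Z}^d$). Let $\xi=\{\xi_t(x)\}_{t\in\mathbb{Z},x\in\mathbb{Z}^d}$ be i.i.d. real with mean zero and variance $\sigma_\xi^2<\infty$. Consider the height process on $\mathbb{R}^{\mathbb{Z}^d}$, $h_{t+1}(x)=\sum_y p(x,y)h_t(y)+\xi_{t+1}(x)$, with $\xi_{t+1}$ independent of $h_t$. (a) If $d\in\{1,2\}$, this Markov chain has no invariant distribution (no probability measure on $\mathbb{R}^{\mathbb{Z}^d}$ is preserved by the evolution). (b) If $d\ge 3$, then the series $\chi_t(x)=\sum_{k=0}^\infty\sum_{z\in\mathbb{Z}^d}\xi_{t-k}(z)p^k(x,z)$, $x\in\mathbb{Z}^d$, $t\in\mathbb{Z}$, converges for almost every $\xi$ and in $L^2(\mathbb{P})$; for almost every $\xi$ the variables $\chi_t(x)$ satisfy $\chi_{t+1}(x)=\sum_yp(x,y)\chi_t(y)+\xi_{t+1}(x)$ for all $t,x$; the process $\{\chi_t\}_{t\in\mathbb{Z}}$ is a stationary version of the height Markov chain, and the field $\{\chi_t(x)\}_{t\in\mathbb{Z},x\in\mathbb{Z}^d}$ is invariant and ergodic under each individual space-time shift $\theta_{x,t}$ with $(x,t)\neq(0,0)$.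
   Context: $p(x,y)=p(y-x)$ and $p^k$ is the $k$-step transition probability. $\mathbb{P}$ is the law of $\xi$. The space-time shift acts by $(\theta_{x,t}\omega)_s(y)=\omega_{s+t}(y+x)$.
   Formalization: The noise variance is assumed strictly positive, $\sigma_\xi^2>0$, in both parts; with $\sigma_\xi^2=0$ part (a) fails, since for $\xi\equiv 0$ the point mass at $h\equiv 0$ is invariant. *)

theory Defs
  imports "HOL-Probability.Probability"
begin

text \<open>Lattice sites are elements of int ^ 'd (the dimension d is CARD('d)).
  The kernel p(x,y) = p(y - x); configurations h : Z^d -> real.\<close>

definition state_space :: "(int ^ 'd \<Rightarrow> real) measure" where
  "state_space = PiM UNIV (\<lambda>_. borel)"

definition spacetime_space :: "(int \<Rightarrow> int ^ 'd \<Rightarrow> real) measure" where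
  "spacetime_space = PiM UNIV (\<lambda>_. state_space)"

definition lnorm :: "int ^ 'd \<Rightarrow> real" where
  "lnorm x = sqrt (\<Sum>i\<in>UNIV. (real_of_int (x $ i))\<^sup>2)"

definition add_subgroup_gen :: "(int ^ 'd) set \<Rightarrow> (int ^ 'd) set" where
  "add_subgroup_gen S = \<Inter>{G. 0 \<in> G \<and> (\<forall>a\<in>G. \<forall>b\<in>G. a + b \<in> G \<and> - a \<in> G) \<and> S \<subseteq> G}"

definition strongly_aperiodic :: "(int ^ 'd \<Rightarrow> real) \<Rightarrow> bool" where
  "strongly_aperiodic p \<longleftrightarrow> (\<forall>u. add_subgroup_gen {u + x | x. p x > 0} = UNIV)"

definition avg :: "(int ^ 'd \<Rightarrow> real) \<Rightarrow> (int ^ 'd \<Rightarrow> real) \<Rightarrow> int ^ 'd \<Rightarrow> real" where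
  "avg p h x = (\<Sum>y\<in>{y. p (y - x) \<noteq> 0}. p (y - x) * h y)"

definition height_step :: "(int ^ 'd \<Rightarrow> real) \<Rightarrow> (int ^ 'd \<Rightarrow> real) \<Rightarrow> (int ^ 'd \<Rightarrow> real) \<Rightarrow> (int ^ 'd \<Rightarrow> real)" where
  "height_step p h e = (\<lambda>x. avg p h x + e x)"

text \<open>k-step transition probability in increment form: p^k(x,z) = step_pow p k (z - x).\<close>
fun step_pow :: "(int ^ 'd \<Rightarrow> real) \<Rightarrow> nat \<Rightarrow> int ^ 'd \<Rightarrow> real" where
  "step_pow p 0 = (\<lambda>z. if z = 0 then 1 else 0)"
| "step_pow p (Suc k) = (\<lambda>z. \<Sum>y\<in>{y. p y \<noteq> 0}. p y * step_pow p k (z - y))"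

definition invariant_distribution ::
  "(int ^ 'd \<Rightarrow> real) \<Rightarrow> real measure \<Rightarrow> (int ^ 'd \<Rightarrow> real) measure \<Rightarrow> bool" where
  "invariant_distribution p \<mu> \<nu> \<longleftrightarrow>
     prob_space \<nu> \<and> sets \<nu> = sets state_space \<and>
     distr (\<nu> \<Otimes>\<^sub>M PiM UNIV (\<lambda>_. \<mu>)) state_space (\<lambda>(h, e). height_step p h e) = \<nu>"

definition chi_term ::
  "(int ^ 'd \<Rightarrow> real) \<Rightarrow> (int \<Rightarrow> int ^ 'd \<Rightarrow> 'a \<Rightarrow> real) \<Rightarrow> nat \<Rightarrow> int \<Rightarrow> int ^ 'd \<Rightarrow> 'a \<Rightarrow> real" where
  "chi_term p \<xi> k t x \<omega> = (\<Sum>z\<in>{z. step_pow p k (z - x) \<noteq> 0}. \<xi> (t - int k) z \<omega> * step_pow p k (z - x))"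

definition chi ::
  "(int ^ 'd \<Rightarrow> real) \<Rightarrow> (int \<Rightarrow> int ^ 'd \<Rightarrow> 'a \<Rightarrow> real) \<Rightarrow> int \<Rightarrow> int ^ 'd \<Rightarrow> 'a \<Rightarrow> real" where
  "chi p \<xi> t x \<omega> = (\<Sum>k. chi_term p \<xi> k t x \<omega>)"

definition st_shift :: "int ^ 'd \<Rightarrow> int \<Rightarrow> (int \<Rightarrow> int ^ 'd \<Rightarrow> real) \<Rightarrow> (int \<Rightarrow> int ^ 'd \<Rightarrow> real)" where
  "st_shift x t \<omega> = (\<lambda>s y. \<omega> (s + t) (y + x))"

definition invariant_and_ergodic :: "'b measure \<Rightarrow> ('b \<Rightarrow> 'b) \<Rightarrow> bool" where
  "invariant_and_ergodic Q T \<longleftrightarrow>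
     T \<in> measurable Q Q \<and> distr Q Q T = Q \<and>
     (\<forall>A\<in>sets Q. T -` A \<inter> space Q = A \<longrightarrow> emeasure Q A = 0 \<or> emeasure Q A = 1)"

end

theory Submission
  imports Defs
begin

text \<open>
  Everything is governed by the collision probabilities \<open>a\<^sub>k = \<Sum>\<^sub>z p\<^sup>k(z)\<^sup>2\<close>, because the \<open>k\<close>-th term
  of the series for \<open>\<chi>\<close> has variance \<open>\<sigma>\<^sup>2 a\<^sub>k\<close> and the terms are independent.

  For \<open>d \<le> 2\<close>, Chebyshev and Cauchy--Schwarz give \<open>a\<^sub>k \<ge> c / k\<close>. Let \<open>h\<close> have an invariant law
  and let \<open>\<phi>\<^sub>k\<close> be the characteristic function of \<open>\<Sum>\<^sub>z p\<^sup>k(z) h(z)\<close>. One step of the evolution yields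
  \<open>\<phi>\<^sub>k(s) = \<phi>\<^sub>k\<^sub>+\<^sub>1(s) \<Prod>\<^sub>z \<psi>(s p\<^sup>k(z))\<close> with \<open>\<psi>\<close> the characteristic function of the noise, and
  \<open>\<bar>\<psi>(u)\<bar> \<le> exp (- c u\<^sup>2)\<close> near \<open>0\<close>. Hence \<open>\<bar>\<phi>\<^sub>0(s)\<bar> \<le> exp (- c s\<^sup>2 \<Sum>\<^sub>k a\<^sub>k) = 0\<close> for small \<open>s \<noteq> 0\<close>,
  contradicting continuity of \<open>\<phi>\<^sub>0\<close> at \<open>0\<close>.

  For \<open>d \<ge> 3\<close>, Parseval on the torus and strong aperiodicity give \<open>a\<^sub>k \<le> C k\<^bsup>-d/2\<^esup>\<close>, which is summable.
  Kolmogorov's maximal inequality then yields almost sure convergence and Fatou's lemma yields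
  convergence in \<open>L\<^sup>2\<close>. The field \<open>\<chi>\<close> is a shift-equivariant function of the i.i.d. noise, whose
  shifts are mixing.
\<close>

section \<open>Series of independent random variables\<close>

text \<open>Partial sums stopped on leaving \<open>(-e, e)\<close>: once an early partial sum is large, so is the
  last stopped one, and the stopped increments remain orthogonal.\<close>

fun freeze :: "real \<Rightarrow> (nat \<Rightarrow> real) \<Rightarrow> nat \<Rightarrow> real" where
  "freeze e x 0 = 0"
| "freeze e x (Suc n) = freeze e x n + indicator {-e<..<e} (freeze e x n) * x n"

lemma freeze_cong: "(\<And>i. i < n \<Longrightarrow> x i = y i) \<Longrightarrow> freeze e x n = freeze e y n"
  by (induction n) auto

text \<open>Outside the open interval the indicator is zero, so the stopped sum no longer
  changes.\<close>

lemma freeze_mono: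
  assumes "k \<le> n" "e \<le> \<bar>freeze e x k\<bar>"
  shows "e \<le> \<bar>freeze e x n\<bar>"
  using assms by (induction n rule: dec_induct) (auto simp: indicator_def)

text \<open>Before the exit the stopped sum agrees with the true partial sum. So if partial sum
  \<open>k\<close> is large, the stopped sum is already large at time \<open>k\<close>, and it stays
  so until \<open>n\<close>.\<close>

lemma freeze_exceeds:
  assumes "k \<le> n" "e \<le> \<bar>\<Sum>i<k. x i\<bar>"
  shows "e \<le> \<bar>freeze e x n\<bar>"
proof -
  have "freeze e x k = (\<Sum>i<k. x i) \<or> e \<le> \<bar>freeze e x k\<bar>" for k
    by (induction k) (auto simp: indicator_def)
  then show ?thesis
    using freeze_mono assms by metis
qed

lemma measurable_freeze:
  assumes "\<And>i. i < n \<Longrightarrow> (\<lambda>w. X i w) \<in> borel_measurable N"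
  shows "(\<lambda>w. freeze e (\<lambda>i. X i w) n) \<in> borel_measurable N"
  using assms by (induction n) auto

text \<open>Whether the sum is still running before step \<open>n\<close> depends only on the first
  \<open>n\<close> variables, hence is independent of the centred \<open>X n\<close>. The cross term
  therefore has mean zero, and stopping can only shrink the new square.\<close>

lemma (in prob_space) freeze_second_moment:
  fixes X :: "nat \<Rightarrow> 'a \<Rightarrow> real"
  assumes ind: "indep_vars (\<lambda>_. borel) X UNIV"
    and sq: "\<And>i. integrable M (\<lambda>\<omega>. (X i \<omega>)\<^sup>2)"
    and mean: "\<And>i. expectation (X i) = 0"
    and e: "e > 0"
  shows "integrable M (\<lambda>\<omega>. (freeze e (\<lambda>i. X i \<omega>) n)\<^sup>2)
    \<and> expectation (\<lambda>\<omega>. (freeze e (\<lambda>i. X i \<omega>) n)\<^sup>2) \<le> (\<Sum>i<n. expectation (\<lambda>\<omega>. (X i \<omega>)\<^sup>2))"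
proof (induction n)
  case 0
  then show ?case by simp
next
  case (Suc n)
  have rv[measurable]: "X i \<in> borel_measurable M" for i
    using ind by (auto simp: indep_vars_def2)
  have int: "integrable M (X i)" for i
    by (rule square_integrable_imp_integrable[OF _ sq]) simp_all
  define F where "F \<omega> = freeze e (\<lambda>i. X i \<omega>) n" for \<omega>
  define g where "g \<omega> = indicat_real {-e<..<e} (F \<omega>)" for \<omega>
  have F[measurable]: "F \<in> borel_measurable M"
    unfolding F_def by (rule measurable_freeze) simp
  have g[measurable]: "g \<in> borel_measurable M"
    unfolding g_def by simp
  \<comment> \<open>\<open>H\<close> presents the stopped factor as a measurable function of the
    first \<open>n\<close> coordinates, the form in which independence of disjoint blocks can be
    used.\<close>
  define H where "H y = freeze e y n * indicat_real {-e<..<e} (freeze e y n)" for y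
  have mH: "H \<in> borel_measurable (PiM {..<n} (\<lambda>_. borel))"
  proof -
    have [measurable]: "(\<lambda>y. freeze e (\<lambda>i. y i) n) \<in> borel_measurable (PiM {..<n} (\<lambda>_. borel))"
      by (rule measurable_freeze) auto
    show ?thesis unfolding H_def by measurable
  qed
  have "indep_var (PiM {..<n} (\<lambda>_. borel)) (\<lambda>\<omega>. restrict (\<lambda>i. X i \<omega>) {..<n})
      (PiM {n} (\<lambda>_. borel)) (\<lambda>\<omega>. restrict (\<lambda>i. X i \<omega>) {n})"
    by (rule indep_var_restrict[OF ind]) auto
  then have "indep_var borel (H \<circ> (\<lambda>\<omega>. restrict (\<lambda>i. X i \<omega>) {..<n}))
      borel ((\<lambda>y. y n) \<circ> (\<lambda>\<omega>. restrict (\<lambda>i. X i \<omega>) {n}))"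
    by (rule indep_var_compose[OF _ mH]) simp
  moreover have "H \<circ> (\<lambda>\<omega>. restrict (\<lambda>i. X i \<omega>) {..<n}) = (\<lambda>\<omega>. F \<omega> * g \<omega>)"
  proof
    fix \<omega>
    have "freeze e (restrict (\<lambda>i. X i \<omega>) {..<n}) n = F \<omega>"
      unfolding F_def by (rule freeze_cong) simp
    then show "(H \<circ> (\<lambda>\<omega>. restrict (\<lambda>i. X i \<omega>) {..<n})) \<omega> = F \<omega> * g \<omega>"
      by (simp add: H_def g_def)
  qed
  moreover have "(\<lambda>y. y n) \<circ> (\<lambda>\<omega>. restrict (\<lambda>i. X i \<omega>) {n}) = X n"
    by auto
  ultimately have iv: "indep_var borel (\<lambda>\<omega>. F \<omega> * g \<omega>) borel (X n)"
    by simp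
  \<comment> \<open>The indicator confines \<open>F\<close> to the interval, so the product is
    bounded by \<open>e\<close>.\<close>
  have iFg: "integrable M (\<lambda>\<omega>. F \<omega> * g \<omega>)"
    using e by (intro integrable_const_bound[where B = e]) (auto simp: g_def indicator_def)
  note cross = indep_var_lebesgue_integral[OF iv iFg int] indep_var_integrable[OF iv iFg int]
  have igX: "integrable M (\<lambda>\<omega>. g \<omega> * (X n \<omega>)\<^sup>2)"
    by (rule Bochner_Integration.integrable_bound[OF sq[of n]]) (auto simp: g_def indicator_def)
  \<comment> \<open>The factor \<open>g\<close> is an indicator, so \<open>g\<close> squared is
    \<open>g\<close>; this is why it appears to the first power in the last summand.\<close>
  have eq: "(freeze e (\<lambda>i. X i \<omega>) (Suc n))\<^sup>2 = ((F \<omega>)\<^sup>2 + 2 * ((F \<omega> * g \<omega>) * X n \<omega>)) + g \<omega> * (X n \<omega>)\<^sup>2" for \<omega>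
    by (simp add: F_def[symmetric] g_def[symmetric])
      (auto simp: g_def indicator_def power2_sum)
  have IH: "integrable M (\<lambda>\<omega>. (F \<omega>)\<^sup>2)"
      "expectation (\<lambda>\<omega>. (F \<omega>)\<^sup>2) \<le> (\<Sum>i<n. expectation (\<lambda>\<omega>. (X i \<omega>)\<^sup>2))"
    using Suc by (auto simp: F_def)
  have "expectation (\<lambda>\<omega>. g \<omega> * (X n \<omega>)\<^sup>2) \<le> expectation (\<lambda>\<omega>. (X n \<omega>)\<^sup>2)"
    by (rule integral_mono[OF igX sq]) (auto simp: g_def indicator_def)
  moreover have "expectation (\<lambda>\<omega>. (freeze e (\<lambda>i. X i \<omega>) (Suc n))\<^sup>2) =
      expectation (\<lambda>\<omega>. (F \<omega>)\<^sup>2) + 2 * expectation (\<lambda>\<omega>. (F \<omega> * g \<omega>) * X n \<omega>)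
        + expectation (\<lambda>\<omega>. g \<omega> * (X n \<omega>)\<^sup>2)"
    unfolding eq using IH(1) cross(2) igX by simp
  ultimately show ?case
    using IH cross igX mean unfolding eq by simp
qed

text \<open>A large partial sum at any time up to \<open>n\<close> leaves the stopped sum large at
  time \<open>n\<close>. One Markov inequality for the square of that single variable thus controls
  all partial sums together.\<close>

lemma (in prob_space) kolmogorov_maximal_inequality:
  fixes X :: "nat \<Rightarrow> 'a \<Rightarrow> real"
  assumes ind: "indep_vars (\<lambda>_. borel) X UNIV"
    and sq: "\<And>i. integrable M (\<lambda>\<omega>. (X i \<omega>)\<^sup>2)"
    and mean: "\<And>i. expectation (X i) = 0"
    and e: "e > 0"
  shows "prob {\<omega>\<in>space M. \<exists>k\<le>n. e \<le> \<bar>\<Sum>i<k. X i \<omega>\<bar>}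
      \<le> (\<Sum>i<n. expectation (\<lambda>\<omega>. (X i \<omega>)\<^sup>2)) / e\<^sup>2"
proof -
  have rv[measurable]: "X i \<in> borel_measurable M" for i
    using ind by (auto simp: indep_vars_def2)
  define F where "F \<omega> = freeze e (\<lambda>i. X i \<omega>) n" for \<omega>
  have F[measurable]: "F \<in> borel_measurable M"
    unfolding F_def by (rule measurable_freeze) simp
  note m = freeze_second_moment[OF ind sq mean e, of n, folded F_def]
  have "prob {\<omega>\<in>space M. \<exists>k\<le>n. e \<le> \<bar>\<Sum>i<k. X i \<omega>\<bar>} \<le> prob {\<omega>\<in>space M. e\<^sup>2 \<le> (F \<omega>)\<^sup>2}"
  proof (rule finite_measure_mono)
    show "{\<omega>\<in>space M. \<exists>k\<le>n. e \<le> \<bar>\<Sum>i<k. X i \<omega>\<bar>} \<subseteq> {\<omega>\<in>space M. e\<^sup>2 \<le> (F \<omega>)\<^sup>2}"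
    proof safe
      fix \<omega> k assume "k \<le> n" "e \<le> \<bar>\<Sum>i<k. X i \<omega>\<bar>"
      then have "e \<le> \<bar>F \<omega>\<bar>"
        unfolding F_def by (rule freeze_exceeds)
      then show "e\<^sup>2 \<le> (F \<omega>)\<^sup>2"
        using e abs_le_square_iff[of e "F \<omega>"] by simp
    qed
  qed measurable
  also have "\<dots> \<le> expectation (\<lambda>\<omega>. (F \<omega>)\<^sup>2) / e\<^sup>2"
    using m e by (intro integral_Markov_inequality_measure[where A = "space M"]) auto
  also have "\<dots> \<le> (\<Sum>i<n. expectation (\<lambda>\<omega>. (X i \<omega>)\<^sup>2)) / e\<^sup>2"
    using m by (intro divide_right_mono) auto
  finally show ?thesis .
qed

text \<open>The maximal inequality, applied to the series started at \<open>m\<close> and passed to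
  infinite length, bounds \<open>prob (B e m)\<close> by a variance tail over the square of
  \<open>e\<close>. As the tails vanish, almost surely for each \<open>j\<close> some tail has all
  its partial sums below \<open>1 / Suc j\<close>, which is the Cauchy criterion.\<close>

theorem (in prob_space) kolmogorov_one_series:
  fixes X :: "nat \<Rightarrow> 'a \<Rightarrow> real"
  assumes ind: "indep_vars (\<lambda>_. borel) X UNIV"
    and sq: "\<And>i. integrable M (\<lambda>\<omega>. (X i \<omega>)\<^sup>2)"
    and mean: "\<And>i. expectation (X i) = 0"
    and summ: "summable (\<lambda>i. expectation (\<lambda>\<omega>. (X i \<omega>)\<^sup>2))"
  shows "AE \<omega> in M. summable (\<lambda>i. X i \<omega>)"
proof -
  have rv[measurable]: "X i \<in> borel_measurable M" for i
    using ind by (auto simp: indep_vars_def2)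
  define v where "v i = expectation (\<lambda>\<omega>. (X i \<omega>)\<^sup>2)" for i
  have v0: "v i \<ge> 0" for i by (simp add: v_def)
  define B where "B e m = {\<omega>\<in>space M. \<exists>k. e \<le> \<bar>\<Sum>i<k. X (i + m) \<omega>\<bar>}" for e :: real and m
  have Bs[measurable]: "B e m \<in> sets M" for e m
    unfolding B_def by measurable
  have B: "prob (B e m) \<le> (\<Sum>i. v (i + m)) / e\<^sup>2" if e: "e > 0" for e m
  proof -
    have indm: "indep_vars (\<lambda>_. borel) (\<lambda>i. X (i + m)) UNIV"
    proof -
      \<comment> \<open>The reindexed family is obtained by grouping the original one into the
        disjoint singleton blocks \<open>{i + m}\<close>.\<close>
      have "indep_vars (\<lambda>i. PiM {i + m} (\<lambda>_. borel)) (\<lambda>i \<omega>. restrict (\<lambda>j. X j \<omega>) {i + m}) UNIV"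
        by (rule indep_vars_restrict[OF ind]) (auto simp: disjoint_family_on_def)
      from indep_vars_compose2[OF this, of "\<lambda>i y. y (i + m)" "\<lambda>_. borel"]
      show ?thesis by (simp cong: measurable_cong_sets)
    qed
    define A where "A n = {\<omega>\<in>space M. \<exists>k\<le>n. e \<le> \<bar>\<Sum>i<k. X (i + m) \<omega>\<bar>}" for n
    have "(\<lambda>n. prob (A n)) \<longlonglongrightarrow> prob (\<Union>n. A n)"
      by (rule finite_Lim_measure_incseq) (auto simp: A_def incseq_def intro: order_trans)
    moreover have "(\<Union>n. A n) = B e m"
      by (auto simp: A_def B_def)
    moreover have "prob (A n) \<le> (\<Sum>i. v (i + m)) / e\<^sup>2" for n
    proof -
      have "prob (A n) \<le> (\<Sum>i<n. v (i + m)) / e\<^sup>2"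
        unfolding A_def v_def
        by (rule kolmogorov_maximal_inequality[OF indm sq mean e])
      also have "\<dots> \<le> (\<Sum>i. v (i + m)) / e\<^sup>2"
        using summ v0 by (intro divide_right_mono sum_le_suminf summable_ignore_initial_segment) (auto simp: v_def)
      finally show ?thesis .
    qed
    ultimately show ?thesis
      by (intro LIMSEQ_le_const2) auto
  qed
  have null: "AE \<omega> in M. \<exists>m. \<omega> \<notin> B (1 / Suc j) m" for j
  proof -
    have "prob (\<Inter>m. B (1 / Suc j) m) \<le> 0"
    proof (rule LIMSEQ_le_const)
      have "(\<lambda>m. (\<Sum>i. v (i + m)) / (1 / Suc j)\<^sup>2) \<longlonglongrightarrow> 0 / (1 / Suc j)\<^sup>2"
        using summ by (intro tendsto_divide suminf_exist_split2) (auto simp: v_def)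
      then show "(\<lambda>m. (\<Sum>i. v (i + m)) / (1 / Suc j)\<^sup>2) \<longlonglongrightarrow> 0" by simp
      have "prob (\<Inter>m. B (1 / Suc j) m) \<le> (\<Sum>i. v (i + m)) / (1 / Suc j)\<^sup>2" for m
        by (rule order_trans[OF finite_measure_mono B]) auto
      then show "\<exists>N. \<forall>m\<ge>N. prob (\<Inter>m. B (1 / Suc j) m) \<le> (\<Sum>i. v (i + m)) / (1 / Suc j)\<^sup>2"
        by blast
    qed
    then have "prob (\<Inter>m. B (1 / Suc j) m) = 0"
      by (simp add: measure_le_0_iff)
    then have "AE \<omega> in M. \<omega> \<notin> (\<Inter>m. B (1 / Suc j) m)"
      by (subst (asm) prob_eq_0) auto
    then show ?thesis by simp
  qed
  have "AE \<omega> in M. \<forall>j. \<exists>m. \<omega> \<notin> B (1 / Suc j) m"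
    using null by (simp add: AE_all_countable)
  then show ?thesis
  proof (rule AE_mp, intro AE_I2 impI)
    fix \<omega> assume w: "\<omega> \<in> space M" and *: "\<forall>j. \<exists>m. \<omega> \<notin> B (1 / Suc j) m"
    show "summable (\<lambda>i. X i \<omega>)"
      unfolding summable_Cauchy
    proof (intro allI impI)
      fix e :: real assume "e > 0"
      then obtain j where j: "1 / Suc j < e / 2"
        using nat_approx_posE[of "e/2"] by auto
      obtain N where N: "\<omega> \<notin> B (1 / Suc j) N" using * by blast
      have bd: "\<bar>\<Sum>i<k. X (i + N) \<omega>\<bar> < e / 2" for k
      proof -
        have "\<not> 1 / Suc j \<le> \<bar>\<Sum>i<k. X (i + N) \<omega>\<bar>"
          using N w unfolding B_def by blast
        then show ?thesis using j by linarith
      qed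
      \<comment> \<open>The block is the difference of two sums started at \<open>N\<close>, each
        below \<open>e / 2\<close>; for \<open>n < m\<close> it is empty.\<close>
      have "norm (\<Sum>i=m..<n. X i \<omega>) < e" if "m \<ge> N" for m n
      proof (cases "m \<le> n")
        case True
        have shift: "(\<Sum>i=N..<l. X i \<omega>) = (\<Sum>i<l-N. X (i + N) \<omega>)" if "N \<le> l" for l
          using that sum.shift_bounds_nat_ivl[of "\<lambda>i. X i \<omega>" 0 N "l - N"]
          by (simp add: atLeast0LessThan)
        have "(\<Sum>i=N..<m. X i \<omega>) + (\<Sum>i=m..<n. X i \<omega>) = (\<Sum>i=N..<n. X i \<omega>)"
          by (rule sum.atLeastLessThan_concat) (use that True in auto)
        then show ?thesis
          using bd[of "m - N"] bd[of "n - N"] shift[of m] shift[of n] that True by auto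
      qed (use \<open>e > 0\<close> in simp)
      then show "\<exists>N. \<forall>m\<ge>N. \<forall>n. norm (\<Sum>i=m..<n. X i \<omega>) < e" by blast
    qed
  qed
qed

section \<open>Orthogonality and mean-square convergence\<close>

lemma (in prob_space) indep_sum_second_moment:
  fixes X :: "'i \<Rightarrow> 'a \<Rightarrow> real"
  assumes "finite A" "indep_vars (\<lambda>_. borel) X A"
    and sq: "\<And>i. i \<in> A \<Longrightarrow> integrable M (\<lambda>\<omega>. (X i \<omega>)\<^sup>2)"
    and mean: "\<And>i. i \<in> A \<Longrightarrow> expectation (X i) = 0"
  shows "integrable M (\<lambda>\<omega>. (\<Sum>i\<in>A. X i \<omega>)\<^sup>2)"
    and "expectation (\<lambda>\<omega>. (\<Sum>i\<in>A. X i \<omega>)\<^sup>2) = (\<Sum>i\<in>A. expectation (\<lambda>\<omega>. (X i \<omega>)\<^sup>2))"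
proof -
  have "integrable M (\<lambda>\<omega>. (\<Sum>i\<in>A. X i \<omega>)\<^sup>2) \<and>
      expectation (\<lambda>\<omega>. (\<Sum>i\<in>A. X i \<omega>)\<^sup>2) = (\<Sum>i\<in>A. expectation (\<lambda>\<omega>. (X i \<omega>)\<^sup>2))"
    using assms
  proof (induction A rule: finite_induct)
    case (insert i A)
    have rv: "X j \<in> borel_measurable M" if "j \<in> insert i A" for j
      using insert.prems(1) that by (auto simp: indep_vars_def2)
    have int: "integrable M (X j)" if "j \<in> insert i A" for j
      by (rule square_integrable_imp_integrable[OF rv[OF that]]) (use insert.prems that in auto)
    have IH: "integrable M (\<lambda>\<omega>. (\<Sum>i\<in>A. X i \<omega>)\<^sup>2)"
        "expectation (\<lambda>\<omega>. (\<Sum>i\<in>A. X i \<omega>)\<^sup>2) = (\<Sum>i\<in>A. expectation (\<lambda>\<omega>. (X i \<omega>)\<^sup>2))"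
      using insert.IH insert.prems indep_vars_subset[OF insert.prems(1), of A] by auto
    have iv: "indep_var borel (X i) borel (\<lambda>\<omega>. \<Sum>i\<in>A. X i \<omega>)"
      by (rule indep_vars_sum) (use insert in auto)
    have intS: "integrable M (\<lambda>\<omega>. \<Sum>i\<in>A. X i \<omega>)" using int by simp
    have i1: "integrable M (X i)" and i2: "integrable M (\<lambda>\<omega>. (X i \<omega>)\<^sup>2)" and m: "expectation (X i) = 0"
      using int insert.prems by auto
    note cross = indep_var_lebesgue_integral[OF iv i1 intS] indep_var_integrable[OF iv i1 intS]
    have eq: "(\<Sum>i\<in>insert i A. X i \<omega>)\<^sup>2 = (X i \<omega>)\<^sup>2 + (\<Sum>i\<in>A. X i \<omega>)\<^sup>2 + 2 * (X i \<omega> * (\<Sum>i\<in>A. X i \<omega>))" for \<omega>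
      using insert.hyps by (simp add: power2_sum)
    show ?case
      unfolding eq using cross i2 IH m insert.hyps by simp
  qed simp
  then show "integrable M (\<lambda>\<omega>. (\<Sum>i\<in>A. X i \<omega>)\<^sup>2)"
    and "expectation (\<lambda>\<omega>. (\<Sum>i\<in>A. X i \<omega>)\<^sup>2) = (\<Sum>i\<in>A. expectation (\<lambda>\<omega>. (X i \<omega>)\<^sup>2))"
    by auto
qed

text \<open>Fatou's lemma along the finite blocks bounds the second moment of the remainder
  \<open>R n\<close> by the variance tail from \<open>n\<close>. The case \<open>n = 0\<close> gives
  square integrability, and letting \<open>n\<close> grow gives convergence.\<close>

theorem (in prob_space) independent_series_L2:
  fixes X :: "nat \<Rightarrow> 'a \<Rightarrow> real"
  assumes ind: "indep_vars (\<lambda>_. borel) X UNIV"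
    and sq: "\<And>i. integrable M (\<lambda>\<omega>. (X i \<omega>)\<^sup>2)"
    and mean: "\<And>i. expectation (X i) = 0"
    and summ: "summable (\<lambda>i. expectation (\<lambda>\<omega>. (X i \<omega>)\<^sup>2))"
  shows "integrable M (\<lambda>\<omega>. (\<Sum>i. X i \<omega>)\<^sup>2)"
    and "(\<lambda>n. expectation (\<lambda>\<omega>. ((\<Sum>i. X i \<omega>) - (\<Sum>i<n. X i \<omega>))\<^sup>2)) \<longlonglongrightarrow> 0"
proof -
  have rv[measurable]: "X i \<in> borel_measurable M" for i
    using ind by (auto simp: indep_vars_def2)
  define v where "v i = expectation (\<lambda>\<omega>. (X i \<omega>)\<^sup>2)" for i
  have v0: "v i \<ge> 0" for i by (simp add: v_def)
  have sv: "summable v" using summ by (simp add: v_def[abs_def])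
  define R where "R n \<omega> = (\<Sum>i. X i \<omega>) - (\<Sum>i<n. X i \<omega>)" for n \<omega>
  have R[measurable]: "R n \<in> borel_measurable M" for n unfolding R_def by measurable
  have bound: "(\<integral>\<^sup>+\<omega>. ennreal ((R n \<omega>)\<^sup>2) \<partial>M) \<le> ennreal (\<Sum>i. v (i + n))" for n
  proof -
    define S where "S m \<omega> = (\<Sum>i\<in>{n..<m + n}. X i \<omega>)" for m \<omega>
    have S[measurable]: "S m \<in> borel_measurable M" for m unfolding S_def by measurable
    have S2: "integrable M (\<lambda>\<omega>. (S m \<omega>)\<^sup>2)" "expectation (\<lambda>\<omega>. (S m \<omega>)\<^sup>2) = (\<Sum>i\<in>{n..<m + n}. v i)" for m
      unfolding S_def v_def
      using indep_sum_second_moment[of "{n..<m + n}" X] indep_vars_subset[OF ind] sq mean by auto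
    have "AE \<omega> in M. (\<lambda>m. (S m \<omega>)\<^sup>2) \<longlonglongrightarrow> (R n \<omega>)\<^sup>2"
      using kolmogorov_one_series[OF assms]
    proof (rule AE_mp, intro AE_I2 impI)
      fix \<omega> assume "summable (\<lambda>i. X i \<omega>)"
      then have "(\<lambda>m. \<Sum>i<m + n. X i \<omega>) \<longlonglongrightarrow> (\<Sum>i. X i \<omega>)"
        by (intro LIMSEQ_ignore_initial_segment summable_LIMSEQ)
      then have "(\<lambda>m. ((\<Sum>i<m + n. X i \<omega>) - (\<Sum>i<n. X i \<omega>))\<^sup>2) \<longlonglongrightarrow> (R n \<omega>)\<^sup>2"
        unfolding R_def by (intro tendsto_intros)
      moreover have "(\<Sum>i<m + n. X i \<omega>) - (\<Sum>i<n. X i \<omega>) = S m \<omega>" for m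
      proof -
        have "(\<Sum>i=0..<n. X i \<omega>) + S m \<omega> = (\<Sum>i=0..<m + n. X i \<omega>)"
          unfolding S_def by (rule sum.atLeastLessThan_concat) auto
        then show ?thesis by (simp add: atLeast0LessThan)
      qed
      ultimately show "(\<lambda>m. (S m \<omega>)\<^sup>2) \<longlonglongrightarrow> (R n \<omega>)\<^sup>2" by simp
    qed
    \<comment> \<open>The pointwise limit is rewritten as a lower limit, the form required by
      Fatou's lemma.\<close>
    then have "AE \<omega> in M. ennreal ((R n \<omega>)\<^sup>2) = liminf (\<lambda>m. ennreal ((S m \<omega>)\<^sup>2))"
    proof (rule AE_mp, intro AE_I2 impI)
      fix \<omega> assume "(\<lambda>m. (S m \<omega>)\<^sup>2) \<longlonglongrightarrow> (R n \<omega>)\<^sup>2"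
      then have "(\<lambda>m. ennreal ((S m \<omega>)\<^sup>2)) \<longlonglongrightarrow> ennreal ((R n \<omega>)\<^sup>2)" by (rule tendsto_ennrealI)
      then show "ennreal ((R n \<omega>)\<^sup>2) = liminf (\<lambda>m. ennreal ((S m \<omega>)\<^sup>2))"
        by (rule lim_imp_Liminf[OF sequentially_bot, symmetric])
    qed
    then have "(\<integral>\<^sup>+\<omega>. ennreal ((R n \<omega>)\<^sup>2) \<partial>M) = (\<integral>\<^sup>+\<omega>. liminf (\<lambda>m. ennreal ((S m \<omega>)\<^sup>2)) \<partial>M)"
      by (rule nn_integral_cong_AE)
    also have "\<dots> \<le> liminf (\<lambda>m. \<integral>\<^sup>+\<omega>. ennreal ((S m \<omega>)\<^sup>2) \<partial>M)"
      by (rule nn_integral_liminf) measurable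
    also have "\<dots> \<le> ennreal (\<Sum>i. v (i + n))"
    proof -
      have "(\<integral>\<^sup>+\<omega>. ennreal ((S m \<omega>)\<^sup>2) \<partial>M) \<le> ennreal (\<Sum>i. v (i + n))" for m
      proof -
        have "(\<integral>\<^sup>+\<omega>. ennreal ((S m \<omega>)\<^sup>2) \<partial>M) = ennreal (\<Sum>i\<in>{n..<m + n}. v i)"
          using S2[of m] by (subst nn_integral_eq_integral) auto
        also have "(\<Sum>i\<in>{n..<m + n}. v i) = (\<Sum>i<m. v (i + n))"
          using sum.shift_bounds_nat_ivl[of v 0 n m] by (simp add: atLeast0LessThan)
        also have "\<dots> \<le> (\<Sum>i. v (i + n))"
          using sv v0 by (intro sum_le_suminf) (auto simp: summable_iff_shift)
        finally show ?thesis by (simp add: ennreal_leI)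
      qed
      then show ?thesis
        by (intro Liminf_le) auto
    qed
    finally show ?thesis .
  qed
  have int: "integrable M (\<lambda>\<omega>. (R n \<omega>)\<^sup>2)" for n
    using bound[of n] by (intro integrableI_bounded) (auto intro: le_less_trans)
  show "integrable M (\<lambda>\<omega>. (\<Sum>i. X i \<omega>)\<^sup>2)"
    using int[of 0] by (simp add: R_def)
  have "expectation (\<lambda>\<omega>. (R n \<omega>)\<^sup>2) \<le> (\<Sum>i. v (i + n))" for n
  proof -
    have "ennreal (expectation (\<lambda>\<omega>. (R n \<omega>)\<^sup>2)) \<le> ennreal (\<Sum>i. v (i + n))"
      using bound[of n] int[of n] by (subst (asm) nn_integral_eq_integral) auto
    then show ?thesis
      using sv v0 by (subst (asm) ennreal_le_iff) (auto intro!: suminf_nonneg simp: summable_iff_shift)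
  qed
  then have "(\<lambda>n. expectation (\<lambda>\<omega>. (R n \<omega>)\<^sup>2)) \<longlonglongrightarrow> 0"
    by (intro tendsto_sandwich[OF _ _ tendsto_const suminf_exist_split2[OF sv]]) auto
  then show "(\<lambda>n. expectation (\<lambda>\<omega>. ((\<Sum>i. X i \<omega>) - (\<Sum>i<n. X i \<omega>))\<^sup>2)) \<longlonglongrightarrow> 0"
    by (simp add: R_def)
qed

section \<open>Collision probabilities of a finite range walk\<close>

text \<open>An interval of half-width \<open>L\<close> holds at most \<open>2 * L + 1\<close>
  integers, which is at most \<open>3 * L\<close> once \<open>L \<ge> 1\<close>; the box is a
  product of such intervals.\<close>

lemma card_int_vec_box:
  fixes a :: "'n::finite \<Rightarrow> real" and L :: real
  assumes "L \<ge> 1"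
  defines "Q \<equiv> {z :: int ^ 'n. \<forall>i. \<bar>z $ i - a i\<bar> \<le> L}"
  shows "finite Q" "card Q \<le> (3 * L) ^ CARD('n)"
proof -
  define P where "P = PiE UNIV (\<lambda>i. {\<lceil>a i - L\<rceil>..\<lfloor>a i + L\<rfloor>})"
  have finP: "finite P" by (auto simp: P_def intro!: finite_PiE)
  have sub: "Q \<subseteq> (\<lambda>f. \<chi> i. f i) ` P"
  proof
    fix z assume "z \<in> Q"
    then have "z $ i \<in> {\<lceil>a i - L\<rceil>..\<lfloor>a i + L\<rfloor>}" for i
      by (auto simp: Q_def abs_le_iff ceiling_le_iff le_floor_iff algebra_simps)
    then show "z \<in> (\<lambda>f. \<chi> i. f i) ` P"
      by (intro image_eqI[of _ _ "\<lambda>i. z $ i"]) (auto simp: P_def)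
  qed
  show "finite Q" using finite_subset[OF sub] finP by blast
  have one: "real (card {\<lceil>a i - L\<rceil>..\<lfloor>a i + L\<rfloor>}) \<le> 3 * L" for i
    proof -
    have "real_of_int (\<lfloor>a i + L\<rfloor> - \<lceil>a i - L\<rceil> + 1) \<le> 2 * L + 1"
      by linarith
    then show ?thesis
      using assms(1) by (cases "\<lfloor>a i + L\<rfloor> - \<lceil>a i - L\<rceil> + 1 \<ge> 0") simp_all
  qed
  have "card Q \<le> card P"
    using card_mono[OF _ sub] card_image_le[OF finP] finP by (meson finite_imageI order_trans)
  also have "real (card P) = (\<Prod>i\<in>UNIV. real (card {\<lceil>a i - L\<rceil>..\<lfloor>a i + L\<rfloor>}))"
    by (simp add: P_def card_PiE)
  also have "\<dots> \<le> (\<Prod>i\<in>(UNIV :: 'n set). 3 * L)"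
    by (rule prod_mono) (use one in auto)
  finally show "card Q \<le> (3 * L) ^ CARD('n)" by simp
qed

locale finite_range_walk =
  fixes p :: "int ^ 'd \<Rightarrow> real"
  assumes finite_supp: "finite {y. p y \<noteq> 0}"
    and p_nonneg: "0 \<le> p y"
    and p_total: "(\<Sum>y | p y \<noteq> 0. p y) = 1"
begin

text \<open>The expectation of \<open>g\<close> at the position of the walk after \<open>k\<close>
  steps. The values lie in any real vector space so that the same lemmas serve real moments and
  complex characters.\<close>

definition walk_sum :: "nat \<Rightarrow> (int ^ 'd \<Rightarrow> 'b::real_vector) \<Rightarrow> 'b" where
  "walk_sum k g = (\<Sum>z | step_pow p k z \<noteq> 0. step_pow p k z *\<^sub>R g z)"

text \<open>The probability that two independent walks started together stand at the same site after
  \<open>k\<close> steps.\<close>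

definition collision :: "nat \<Rightarrow> real" where
  "collision k = (\<Sum>z | step_pow p k z \<noteq> 0. (step_pow p k z)\<^sup>2)"

lemma finite_step_supp: "finite {z. step_pow p k z \<noteq> 0}"
proof (induction k)
  case (Suc k)
  have "{z. step_pow p (Suc k) z \<noteq> 0} \<subseteq>
      (\<lambda>(y, w). y + w) ` ({y. p y \<noteq> 0} \<times> {w. step_pow p k w \<noteq> 0})"
  proof
    fix z assume "z \<in> {z. step_pow p (Suc k) z \<noteq> 0}"
    then obtain y where "p y \<noteq> 0" "step_pow p k (z - y) \<noteq> 0"
      by (auto elim!: sum.not_neutral_contains_not_neutral)
    then show "z \<in> (\<lambda>(y, w). y + w) ` ({y. p y \<noteq> 0} \<times> {w. step_pow p k w \<noteq> 0})"
      by (intro image_eqI[of _ _ "(y, z - y)"]) auto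
  qed
  then show ?case
    using Suc finite_supp by (blast intro: finite_subset finite_imageI finite_cartesian_product)
qed simp

lemma step_nonneg: "0 \<le> step_pow p k z"
  by (induction k arbitrary: z) (auto intro!: sum_nonneg simp: p_nonneg)

lemma walk_sum_superset:
  assumes "finite C" "\<And>z. step_pow p k z \<noteq> 0 \<Longrightarrow> g z \<noteq> 0 \<Longrightarrow> z \<in> C"
  shows "walk_sum k g = (\<Sum>z\<in>C. step_pow p k z *\<^sub>R g z)"
proof -
  have "walk_sum k g = (\<Sum>z\<in>C \<union> {z. step_pow p k z \<noteq> 0}. step_pow p k z *\<^sub>R g z)"
    unfolding walk_sum_def using assms finite_step_supp by (intro sum.mono_neutral_left) auto
  also have "\<dots> = (\<Sum>z\<in>C. step_pow p k z *\<^sub>R g z)"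
    using assms finite_step_supp by (intro sum.mono_neutral_right) auto
  finally show ?thesis .
qed

lemma walk_sum_0 [simp]: "walk_sum 0 g = g 0"
proof -
  have "{z. (if z = 0 then 1 else 0) \<noteq> (0::real)} = {0 :: int ^ 'd}" by auto
  then show ?thesis by (simp add: walk_sum_def)
qed

text \<open>Conditioning on the first step. Both sums are taken over one finite set \<open>C\<close>
  holding every sum of a first step and a \<open>k\<close>-step position, so that they can be
  exchanged.\<close>

lemma walk_sum_Suc:
  "walk_sum (Suc k) g = (\<Sum>y | p y \<noteq> 0. p y *\<^sub>R walk_sum k (\<lambda>w. g (y + w)))"
proof -
  define A where "A = {y. p y \<noteq> 0}"
  define B where "B = {w. step_pow p k w \<noteq> 0}"
  define C where "C = (\<lambda>(y, w). y + w) ` (A \<times> B)"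
  have fin: "finite A" "finite B" "finite C"
    using finite_supp finite_step_supp by (auto simp: A_def B_def C_def)
  have inner: "(\<Sum>z\<in>C. step_pow p k (z - y) *\<^sub>R g z) = walk_sum k (\<lambda>w. g (y + w))" if "y \<in> A" for y
  proof -
    have "(\<Sum>z\<in>C. step_pow p k (z - y) *\<^sub>R g z) = (\<Sum>z\<in>(\<lambda>w. y + w) ` B. step_pow p k (z - y) *\<^sub>R g z)"
      using fin that
      by (intro sum.mono_neutral_right) (auto simp: C_def B_def image_iff, metis add_diff_cancel_left' diff_add_cancel add.commute)
    also have "\<dots> = (\<Sum>w\<in>B. step_pow p k w *\<^sub>R g (y + w))"
      by (subst sum.reindex) (auto simp: inj_on_def)
    finally show ?thesis by (simp add: walk_sum_def B_def)
  qed
  have "walk_sum (Suc k) g = (\<Sum>z\<in>C. step_pow p (Suc k) z *\<^sub>R g z)"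
  proof (rule walk_sum_superset[OF fin(3)])
    fix z assume "step_pow p (Suc k) z \<noteq> 0"
    then obtain y where "p y \<noteq> 0" "step_pow p k (z - y) \<noteq> 0"
      by (auto elim!: sum.not_neutral_contains_not_neutral)
    then show "z \<in> C"
      unfolding C_def A_def B_def by (intro image_eqI[of _ _ "(y, z - y)"]) auto
  qed
  also have "\<dots> = (\<Sum>z\<in>C. \<Sum>y\<in>A. p y *\<^sub>R (step_pow p k (z - y) *\<^sub>R g z))"
    by (simp add: A_def scaleR_sum_left)
  also have "\<dots> = (\<Sum>y\<in>A. \<Sum>z\<in>C. p y *\<^sub>R (step_pow p k (z - y) *\<^sub>R g z))"
    by (rule sum.swap)
  also have "\<dots> = (\<Sum>y\<in>A. p y *\<^sub>R walk_sum k (\<lambda>w. g (y + w)))"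
    by (rule sum.cong) (auto simp: inner[symmetric] scaleR_sum_right)
  finally show ?thesis by (simp add: A_def)
qed

lemma walk_sum_add: "walk_sum k (\<lambda>z. f z + g z) = walk_sum k f + walk_sum k g"
  by (simp add: walk_sum_def scaleR_right_distrib sum.distrib)

lemma walk_sum_mult_left: "walk_sum k (\<lambda>z. c * g z) = c * walk_sum k (g :: _ \<Rightarrow> 'b::real_algebra)"
  by (simp add: walk_sum_def sum_distrib_left)

lemma walk_sum_sum: "walk_sum k (\<lambda>z. \<Sum>i\<in>I. g i z) = (\<Sum>i\<in>I. walk_sum k (g i))"
  unfolding walk_sum_def by (subst sum.swap) (simp add: scaleR_sum_right)

lemma walk_sum_const [simp]: "walk_sum k (\<lambda>_. c :: real) = c"
proof (induction k)
  case (Suc k)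
  then show ?case by (simp add: walk_sum_Suc sum_distrib_right[symmetric] p_total)
qed simp

lemma walk_sum_mono:
  fixes f g :: "int ^ 'd \<Rightarrow> real"
  assumes "\<And>z. f z \<le> g z"
  shows "walk_sum k f \<le> walk_sum k g"
  unfolding walk_sum_def by (auto intro!: sum_mono mult_left_mono assms step_nonneg)

lemma collision_nonneg: "0 \<le> collision k"
  by (auto simp: collision_def intro: sum_nonneg)

section \<open>Moments of the walk and the lower bound in low dimension\<close>

definition drift :: "'d \<Rightarrow> real" where
  "drift i = (\<Sum>y | p y \<noteq> 0. p y * y $ i)"

text \<open>The trace of the covariance matrix of a single step.\<close>

definition spread :: real where
  "spread = (\<Sum>y | p y \<noteq> 0. p y * (\<Sum>i\<in>UNIV. (y $ i - drift i)\<^sup>2))"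

lemma walk_first_moment: "walk_sum k (\<lambda>z. real_of_int (z $ i) - k * drift i) = 0"
proof (induction k)
  case (Suc k)
  have "walk_sum (Suc k) (\<lambda>z. real_of_int (z $ i) - Suc k * drift i) =
     (\<Sum>y | p y \<noteq> 0. p y * walk_sum k (\<lambda>w. (real_of_int (w $ i) - k * drift i) + (y $ i - drift i)))"
    unfolding walk_sum_Suc by (simp add: algebra_simps)
  also have "\<dots> = (\<Sum>y | p y \<noteq> 0. p y * (y $ i - drift i))"
    by (simp add: walk_sum_add Suc)
  also have "\<dots> = drift i - (\<Sum>y | p y \<noteq> 0. p y) * drift i"
    by (simp add: drift_def right_diff_distrib sum_subtractf sum_distrib_right)
  finally show ?case by (simp add: p_total)
qed simp

text \<open>Splitting off the first step, the square expands into the old fluctuation, the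
  fluctuation of the step, and a cross term killed by \<open>walk_first_moment\<close>. Each step
  thus adds \<open>spread\<close>.\<close>

lemma walk_second_moment:
  "walk_sum k (\<lambda>z. \<Sum>i\<in>UNIV. (real_of_int (z $ i) - k * drift i)\<^sup>2) = k * spread"
proof (induction k)
  case (Suc k)
  have step: "walk_sum k (\<lambda>w. \<Sum>i\<in>UNIV. (real_of_int ((y + w) $ i) - Suc k * drift i)\<^sup>2)
      = k * spread + (\<Sum>i\<in>UNIV. (y $ i - drift i)\<^sup>2)" for y
  proof -
    have "walk_sum k (\<lambda>w. \<Sum>i\<in>UNIV. (real_of_int ((y + w) $ i) - Suc k * drift i)\<^sup>2)
      = walk_sum k (\<lambda>w. (\<Sum>i\<in>UNIV. (real_of_int (w $ i) - k * drift i)\<^sup>2) +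
          ((\<Sum>i\<in>UNIV. (2 * (y $ i - drift i)) * (real_of_int (w $ i) - k * drift i)) +
           (\<Sum>i\<in>UNIV. (y $ i - drift i)\<^sup>2)))"
      unfolding sum.distrib[symmetric]
      by (intro arg_cong[where f = "walk_sum k"] ext sum.cong refl)
        (simp add: power2_eq_square algebra_simps)
    also have "\<dots> = k * spread + (\<Sum>i\<in>UNIV. (y $ i - drift i)\<^sup>2)"
      by (simp add: walk_sum_add walk_sum_sum walk_sum_mult_left walk_first_moment Suc[unfolded walk_sum_sum])
    finally show ?thesis .
  qed
  have "walk_sum (Suc k) (\<lambda>z. \<Sum>i\<in>UNIV. (real_of_int (z $ i) - Suc k * drift i)\<^sup>2)
      = (\<Sum>y | p y \<noteq> 0. p y * (k * spread + (\<Sum>i\<in>UNIV. (y $ i - drift i)\<^sup>2)))"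
    unfolding walk_sum_Suc step by simp
  also have "\<dots> = (\<Sum>y | p y \<noteq> 0. p y) * (k * spread) + spread"
    by (simp add: distrib_left sum.distrib sum_distrib_right spread_def)
  finally show ?case by (simp add: p_total algebra_simps)
qed simp

text \<open>By Chebyshev at least half of the mass lies in a box of side of order the square root of
  \<open>k\<close>. In dimension at most two this box has at most a multiple of \<open>k\<close>
  sites, and by Cauchy-Schwarz mass on few sites forces a large sum of squares.\<close>

lemma collision_lower_bound:
  assumes dim: "CARD('d) \<le> 2"
  shows "\<exists>c>0. \<forall>k\<ge>1. c / real k \<le> collision k"
proof -
  \<comment> \<open>The bound by \<open>2 * spread\<close> limits the Chebyshev loss to one half;
    the bound by 1 ensures \<open>L \<ge> 1\<close> for the counting of the box.\<close>
  define D where "D = max 1 (2 * spread)"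
  have D: "D \<ge> 1" "2 * spread \<le> D" by (auto simp: D_def)
  \<comment> \<open>The constant 36 is 4 times 9: the 4 from squaring the mass one half, the 9 from
    the box count.\<close>
  have "(1 / (36 * D)) / real k \<le> collision k" if k: "k \<ge> 1" for k :: nat
  proof -
    define L where "L = sqrt (D * k)"
    have Dk: "D * k \<ge> 1" using D(1) k mult_mono[of 1 D 1 "real k"] by simp
    have L: "L \<ge> 1" "L\<^sup>2 = D * k" using Dk by (auto simp: L_def)
    define Q where "Q = {z :: int ^ 'd. \<forall>i. \<bar>z $ i - k * drift i\<bar> \<le> L}"
    note Q = card_int_vec_box[OF L(1), of "\<lambda>i. k * drift i", folded Q_def]
    \<comment> \<open>Raising the exponent to 2 treats dimensions one and two together.\<close>
    have "(3 * L) ^ CARD('d) \<le> (3 * L)\<^sup>2"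
      using L(1) dim by (intro power_increasing) auto
    then have cardQ: "card Q \<le> 9 * (D * k)"
      using Q(2) L(2) by (simp add: power_mult_distrib)
    have "1 = walk_sum k (\<lambda>_. 1 :: real)" by simp
    \<comment> \<open>Chebyshev in pointwise form: off the box, some coordinate alone contributes at
      least the square of \<open>L\<close>.\<close>
    also have "\<dots> \<le> walk_sum k (\<lambda>z. indicat_real Q z +
        (1 / L\<^sup>2) * (\<Sum>i\<in>UNIV. (real_of_int (z $ i) - k * drift i)\<^sup>2))"
    proof (rule walk_sum_mono)
      fix z :: "int ^ 'd"
      show "1 \<le> indicat_real Q z + (1 / L\<^sup>2) * (\<Sum>i\<in>UNIV. (real_of_int (z $ i) - k * drift i)\<^sup>2)"
      proof (cases "z \<in> Q")
        case True
        then show ?thesis by (simp add: sum_nonneg)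
      next
        case False
        then obtain i where "\<not> \<bar>z $ i - k * drift i\<bar> \<le> L" unfolding Q_def by blast
        then have "L\<^sup>2 \<le> (z $ i - k * drift i)\<^sup>2"
          using L(1) abs_le_square_iff[of L "z $ i - k * drift i"] by simp
        also have "\<dots> \<le> (\<Sum>i\<in>UNIV. (z $ i - k * drift i)\<^sup>2)"
          by (rule member_le_sum) auto
        finally show ?thesis using L(1) False by (simp add: field_simps)
      qed
    qed
    also have "\<dots> = walk_sum k (indicat_real Q) + (1 / L\<^sup>2) * (k * spread)"
      by (simp add: walk_sum_add walk_sum_mult_left walk_second_moment del: times_divide_eq_left)
    also have "(1 / L\<^sup>2) * (k * spread) \<le> 1 / 2"
      using D k L(2) by (simp add: field_simps)
    finally have half: "1 / 2 \<le> walk_sum k (indicat_real Q)" by simp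
    have "walk_sum k (indicat_real Q) = (\<Sum>z\<in>Q. step_pow p k z * 1)"
      using Q(1) by (subst walk_sum_superset[of Q]) (auto simp: indicator_def split: if_splits)
    with half have "(1/2)\<^sup>2 \<le> (\<Sum>z\<in>Q. step_pow p k z * 1)\<^sup>2"
      by (intro power_mono) auto
    also have "\<dots> \<le> (\<Sum>z\<in>Q. (step_pow p k z)\<^sup>2) * (\<Sum>z\<in>Q. 1\<^sup>2)"
      by (rule Cauchy_Schwarz_ineq_sum)
    also have "(\<Sum>z\<in>Q. (step_pow p k z)\<^sup>2) \<le> collision k"
    proof -
      have "(\<Sum>z\<in>Q. (step_pow p k z)\<^sup>2) = (\<Sum>z\<in>Q \<inter> {z. step_pow p k z \<noteq> 0}. (step_pow p k z)\<^sup>2)"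
        using Q(1) by (intro sum.mono_neutral_right) auto
      also have "\<dots> \<le> collision k"
        unfolding collision_def using finite_step_supp by (intro sum_mono2) auto
      finally show ?thesis .
    qed
    finally have "1 / 4 \<le> collision k * card Q"
      by (simp add: power2_eq_square mult_right_mono)
    also have "\<dots> \<le> collision k * (9 * (D * k))"
      using cardQ by (intro mult_left_mono collision_nonneg)
    finally show ?thesis
      using D k by (simp add: field_simps)
  qed
  then show ?thesis
    using D by (intro exI[of _ "1 / (36 * D)"]) auto
qed

lemma collision_not_summable:
  assumes "CARD('d) \<le> 2"
  shows "\<not> summable collision"
proof
  obtain c where c: "c > 0" "\<And>k. k \<ge> 1 \<Longrightarrow> c / real k \<le> collision k"
    using collision_lower_bound[OF assms] by blast
  assume "summable collision"
  then have "summable (\<lambda>k. c * (1 / real k))"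
    by (rule summable_comparison_test') (use c in \<open>auto intro!: exI[of _ 1]\<close>)
  then have "summable (\<lambda>k. 1 / real k)"
    using c(1) by (simp add: summable_cmult_iff del: times_divide_eq_right)
  then show False
    using not_summable_harmonic[where ?'a = real] by (simp add: inverse_eq_divide)
qed

end

section \<open>Fourier bound for the collision probabilities\<close>

text \<open>The fourth-order Taylor bound leaves an error of one 24th of the fourth power of
  \<open>x\<close>. On this interval the square of \<open>x\<close> is at most
  \<open>(3.2)\<^sup>2\<close>, so the error costs at most 9/20 of the square, and 1/2 - 9/20 =
  1/20.\<close>

lemma cos_upper_quadratic:
  assumes "\<bar>x\<bar> \<le> pi"
  shows "x\<^sup>2 / 20 \<le> 1 - cos x"
proof -
  obtain t where t: "cos x = (\<Sum>m<4. cos_coeff m * x ^ m) + (cos (t + 1/2 * real 4 * pi) / fact 4) * x ^ 4"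
    using Maclaurin_cos_expansion[of x 4] by blast
  have "(\<Sum>m<4. cos_coeff m * x ^ m) = 1 - x\<^sup>2 / 2"
    by (simp add: cos_coeff_def lessThan_nat_numeral)
  with t have "cos x = 1 - x\<^sup>2 / 2 + cos (t + 2 * pi) / 24 * x ^ 4"
    by (simp add: fact_numeral)
  also have "\<dots> \<le> 1 - x\<^sup>2 / 2 + 1 / 24 * x ^ 4"
    by (intro add_left_mono mult_right_mono divide_right_mono) auto
  also have "x ^ 4 = x\<^sup>2 * x\<^sup>2" by (simp add: eval_nat_numeral)
  also have "x\<^sup>2 * x\<^sup>2 \<le> x\<^sup>2 * (3.2)\<^sup>2"
  proof (intro mult_left_mono)
    have "\<bar>x\<bar> \<le> 3.2" using assms pi_less_4 pi_approx by simp
    then show "x\<^sup>2 \<le> (3.2)\<^sup>2" using abs_le_square_iff[of x "3.2"] by simp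
  qed simp
  finally have "cos x \<le> 1 - x\<^sup>2 / 2 + 1 / 24 * (x\<^sup>2 * (3.2)\<^sup>2)" by simp
  moreover have "1 / 24 * (x\<^sup>2 * (3.2)\<^sup>2) \<le> x\<^sup>2 * (9 / 20)"
    using mult_left_mono[of "1 / 24 * (3.2)\<^sup>2" "9/20 :: real" "x\<^sup>2"] by (simp add: power2_eq_square)
  ultimately show ?thesis by linarith
qed

text \<open>In half angles \<open>1 - cos\<close> is twice a squared sine, so the addition formula
  and the bound of a squared sum by twice the sum of squares suffice. This yields closure under
  addition in the spectral gap argument.\<close>

lemma one_minus_cos_add: "1 - cos (a + b) \<le> 2 * (1 - cos a) + 2 * (1 - cos (b :: real))"
proof -
  define s t where "s = a / 2" and "t = b / 2"
  have half: "1 - cos (2 * u) = 2 * (sin u)\<^sup>2" for u :: real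
    by (simp add: cos_double_sin)
  have c1: "(cos u)\<^sup>2 \<le> 1" for u :: real
    by (simp add: abs_square_le_1)
  have "(sin (s + t))\<^sup>2 \<le> 2 * (sin s * cos t)\<^sup>2 + 2 * (cos s * sin t)\<^sup>2"
    using sum_squares_ge_zero[of "sin s * cos t - cos s * sin t" 0]
    by (simp add: sin_add power2_eq_square algebra_simps)
  also have "\<dots> \<le> 2 * (sin s)\<^sup>2 + 2 * (sin t)\<^sup>2"
    using mult_left_le[OF c1[of t], of "(sin s)\<^sup>2"] mult_left_le[OF c1[of s], of "(sin t)\<^sup>2"]
    by (simp add: power_mult_distrib mult.commute)
  finally have "1 - cos (2 * (s + t)) \<le> 2 * (1 - cos (2 * s)) + 2 * (1 - cos (2 * t))"
    unfolding half by simp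
  moreover have "2 * (s + t) = a + b" "2 * s = a" "2 * t = b"
    by (simp_all add: s_def t_def)
  ultimately show ?thesis by simp
qed

section \<open>Integration on the circle and the torus\<close>

lemma measurable_cis [measurable]: "cis \<in> borel_measurable borel"
  by (intro borel_measurable_continuous_onI continuous_intros)

text \<open>One full period with unnormalised Lebesgue measure, so the total mass is
  \<open>2 * pi\<close>.\<close>

definition circle_measure :: "real measure" where
  "circle_measure = restrict_space lborel {-pi..pi}"

lemma finite_measure_circle: "finite_measure circle_measure"
  by (rule finite_measureI) (simp add: circle_measure_def emeasure_restrict_space space_restrict_space)

lemma measurable_circle: "f \<in> borel_measurable borel \<Longrightarrow> f \<in> borel_measurable circle_measure"
  unfolding circle_measure_def by (intro measurable_restrict_space1) simp

lemma integrable_circle_bounded: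
  fixes f :: "real \<Rightarrow> 'b::{banach, second_countable_topology}"
  assumes "f \<in> borel_measurable borel" "\<And>x. norm (f x) \<le> B"
  shows "integrable circle_measure f"
  using assms by (intro finite_measure.integrable_const_bound[OF finite_measure_circle, of _ B] measurable_circle) auto

lemma integral_circle_cis:
  "(\<integral>x. cis (of_int n * x) \<partial>circle_measure) = (if n = 0 then 2 * pi else 0)"
proof -
  have eq: "(\<integral>x. cis (of_int n * x) \<partial>circle_measure) = (LBINT x=-pi..pi. cis (of_int n * x))"
    by (simp add: circle_measure_def integral_restrict_space interval_integral_Icc set_lebesgue_integral_def)
  show ?thesis
  proof (cases "n = 0")
    case True
    then show ?thesis
      by (simp add: circle_measure_def measure_restrict_space scaleR_conv_of_real)
  next
    case False
    have "(LBINT x=-pi..pi. cis (of_int n * x)) =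
        cis (of_int n * pi) / (\<i> * of_int n) - cis (of_int n * (-pi)) / (\<i> * of_int n)"
    proof (rule interval_integral_FTC_finite)
      fix x :: real
      show "((\<lambda>x. cis (of_int n * x) / (\<i> * of_int n)) has_vector_derivative cis (of_int n * x))
          (at x within {min (-pi) pi..max (-pi) pi})"
        unfolding cis_conv_exp of_real_mult
        using False
        by (intro has_vector_derivative_real_field[of "\<lambda>w. exp (\<i> * (of_real (of_int n) * w)) / (\<i> * of_int n)"])
          (auto intro!: derivative_eq_intros simp: ac_simps)
    qed (auto intro!: continuous_intros)
    also have "cis (of_int n * (-pi)) = cis (of_int n * pi)"
      by (simp add: complex_eq_iff mult.commute[of "of_int n"] sin_integer_2pi sin_npi_int)
    finally show ?thesis using False eq by simp
  qed
qed

text \<open>The quadratic bound on \<open>1 - cos x\<close> dominates the integrand by a Gaussian,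
  whose integral over the whole line is known.\<close>

lemma integral_circle_exp_cos:
  assumes s: "s > 0"
  shows "(\<integral>x. exp (- s * (1 - cos x)) \<partial>circle_measure) \<le> sqrt (20 * pi / s)"
proof -
  \<comment> \<open>The variance \<open>10 / s\<close> makes the Gaussian exponent equal to
    \<open>s * (x\<^sup>2 / 20)\<close>.\<close>
  define \<sigma> where "\<sigma> = sqrt (10 / s)"
  have \<sigma>: "\<sigma> > 0" "\<sigma>\<^sup>2 = 10 / s" using s by (auto simp: \<sigma>_def)
  have int: "integrable circle_measure (\<lambda>x. exp (- s * (1 - cos x)))"
    using s by (intro integrable_circle_bounded[of _ 1]) (auto simp: mult_nonneg_nonneg)
  have "(\<integral>x. exp (- s * (1 - cos x)) \<partial>circle_measure) = (\<integral>x. indicat_real {-pi..pi} x * exp (- s * (1 - cos x)) \<partial>lborel)"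
    by (simp add: circle_measure_def integral_restrict_space)
  also have "\<dots> \<le> (\<integral>x. sqrt (2 * pi * \<sigma>\<^sup>2) * normal_density 0 \<sigma> x \<partial>lborel)"
  proof (rule integral_mono)
    show "integrable lborel (\<lambda>x. indicat_real {-pi..pi} x * exp (- s * (1 - cos x)))"
      using int by (simp add: circle_measure_def integrable_restrict_space)
    show "integrable lborel (\<lambda>x. sqrt (2 * pi * \<sigma>\<^sup>2) * normal_density 0 \<sigma> x)"
      using \<sigma> by simp
    fix x :: real
    have "exp (- s * (1 - cos x)) \<le> exp (- x\<^sup>2 / (2 * \<sigma>\<^sup>2))" if "x \<in> {-pi..pi}"
    proof -
      have "s * (x\<^sup>2 / 20) \<le> s * (1 - cos x)"
        using that s by (intro mult_left_mono cos_upper_quadratic) auto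
      moreover have "x\<^sup>2 / (2 * \<sigma>\<^sup>2) = s * (x\<^sup>2 / 20)"
        unfolding \<sigma>(2) using s by simp
      ultimately show ?thesis by simp
    qed
    moreover have "sqrt (2 * pi * \<sigma>\<^sup>2) * normal_density 0 \<sigma> x = exp (- x\<^sup>2 / (2 * \<sigma>\<^sup>2))"
      using \<sigma>(1) by (simp add: normal_density_def)
    ultimately show "indicat_real {-pi..pi} x * exp (- s * (1 - cos x)) \<le> sqrt (2 * pi * \<sigma>\<^sup>2) * normal_density 0 \<sigma> x"
      by (auto simp: indicator_def)
  qed
  also have "\<dots> = sqrt (2 * pi * \<sigma>\<^sup>2)"
    using \<sigma> by simp
  also have "2 * pi * \<sigma>\<^sup>2 = 20 * pi / s"
    using \<sigma> by simp
  finally show ?thesis .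
qed

definition inner_angle :: "int ^ 'd \<Rightarrow> ('d \<Rightarrow> real) \<Rightarrow> real" where
  "inner_angle z \<theta> = (\<Sum>i\<in>UNIV. of_int (z $ i) * \<theta> i)"

lemma inner_angle_add: "inner_angle (y + z) \<theta> = inner_angle y \<theta> + inner_angle z \<theta>"
  and inner_angle_diff: "inner_angle (y - z) \<theta> = inner_angle y \<theta> - inner_angle z \<theta>"
  and inner_angle_minus: "inner_angle (- z) \<theta> = - inner_angle z \<theta>"
  and inner_angle_0: "inner_angle 0 \<theta> = 0"
  by (simp_all add: inner_angle_def algebra_simps sum.distrib sum_subtractf sum_negf)

lemma inner_angle_axis: "inner_angle (axis i 1) \<theta> = \<theta> i"
  by (simp add: inner_angle_def axis_def if_distrib if_distribR sum.delta cong: if_cong)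

abbreviation torus :: "('d \<Rightarrow> real) measure" where
  "torus \<equiv> PiM UNIV (\<lambda>_. circle_measure)"

lemma cis_sum: "cis (\<Sum>i\<in>A. f i) = (\<Prod>i\<in>A. cis (f i))"
  by (induction A rule: infinite_finite_induct) (simp_all add: cis_mult[symmetric])

lemma product_sigma_finite_circle: "product_sigma_finite (\<lambda>_::'d. circle_measure)"
  by (simp add: product_sigma_finite_def finite_measure.axioms(1) finite_measure_circle)

lemma finite_measure_torus: "finite_measure (torus :: ('d::finite \<Rightarrow> real) measure)"
proof -
  interpret product_sigma_finite "\<lambda>_::'d. circle_measure" by (rule product_sigma_finite_circle)
  interpret A: finite_measure circle_measure by (rule finite_measure_circle)
  show ?thesis
    by (rule finite_measureI)
      (simp add: space_PiM emeasure_PiM A.emeasure_eq_measure power_eq_top_ennreal)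
qed

text \<open>The character is a product over coordinates, so the integral factors into circle
  integrals, and any nonzero coordinate of \<open>z\<close> makes one factor vanish.\<close>

lemma integral_torus_character:
  "(\<integral>\<theta>. cis (inner_angle z \<theta>) \<partial>torus) = (if z = 0 then (2 * pi) ^ CARD('d) else 0)"
  for z :: "int ^ 'd"
proof -
  interpret product_sigma_finite "\<lambda>_::'d. circle_measure" by (rule product_sigma_finite_circle)
  have "(\<integral>\<theta>. cis (inner_angle z \<theta>) \<partial>torus) = (\<integral>\<theta>. (\<Prod>i\<in>UNIV. cis (of_int (z $ i) * \<theta> i)) \<partial>torus)"
    by (simp add: inner_angle_def cis_sum)
  also have "\<dots> = (\<Prod>i\<in>UNIV. \<integral>x. cis (of_int (z $ i) * x) \<partial>circle_measure)"
    by (rule product_integral_prod[of UNIV "\<lambda>i x. cis (of_int (z $ i) * x)"])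
       (auto intro!: integrable_circle_bounded[of _ 1])
  also have "\<dots> = (\<Prod>i\<in>(UNIV :: 'd set). if z $ i = 0 then 2 * pi else 0)"
    by (simp add: integral_circle_cis)
  also have "\<dots> = (if z = 0 then (2 * pi) ^ CARD('d) else 0)"
    by (auto simp: vec_eq_iff prod_zero_iff intro: prod.neutral)
  finally show ?thesis .
qed

lemma measurable_torus_component [measurable]:
  "(\<lambda>\<theta>. \<theta> i) \<in> borel_measurable (torus :: ('d::finite \<Rightarrow> real) measure)"
proof -
  have "(\<lambda>\<theta>. \<theta> i) \<in> measurable (torus :: ('d \<Rightarrow> real) measure) circle_measure"
    by (rule measurable_component_singleton) simp
  from measurable_compose[OF this measurable_circle[of "\<lambda>x. x"]] show ?thesis by simp
qed

lemma measurable_inner_angle [measurable]: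
  "inner_angle z \<in> borel_measurable torus"
  unfolding inner_angle_def by measurable

section \<open>Parseval's identity and the spectral gap\<close>

context finite_range_walk
begin

definition walk_char :: "('d \<Rightarrow> real) \<Rightarrow> complex" where
  "walk_char \<theta> = (\<Sum>y | p y \<noteq> 0. p y *\<^sub>R cis (inner_angle y \<theta>))"

lemma walk_sum_character: "walk_sum k (\<lambda>z. cis (inner_angle z \<theta>)) = walk_char \<theta> ^ k"
proof (induction k)
  case (Suc k)
  then show ?case
    by (simp add: walk_sum_Suc inner_angle_add cis_mult[symmetric] walk_sum_mult_left walk_char_def
        sum_distrib_right)
qed (simp add: inner_angle_0)

lemma norm_walk_char_power:
  "complex_of_real (norm (walk_char \<theta> ^ k) ^ 2) =
    (\<Sum>z | step_pow p k z \<noteq> 0. \<Sum>w | step_pow p k w \<noteq> 0.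
      complex_of_real (step_pow p k z * step_pow p k w) * cis (inner_angle (z - w) \<theta>))"
  unfolding complex_norm_square walk_sum_character[symmetric] walk_sum_def
  by (simp add: sum_product inner_angle_diff cis_divide[symmetric] cis_cnj scaleR_conv_of_real
      divide_inverse mult_ac del: of_real_power flip: cis_inverse)

text \<open>Parseval's identity: the squared modulus expands into a double sum of characters, of
  which integration keeps only the diagonal.\<close>

lemma collision_eq_integral:
  "(2 * pi) ^ CARD('d) * collision k = (\<integral>\<theta>. norm (walk_char \<theta>) ^ (2 * k) \<partial>torus)"
proof -
  interpret F: finite_measure "torus :: ('d \<Rightarrow> real) measure" by (rule finite_measure_torus)
  define S where "S = {z. step_pow p k z \<noteq> 0}"
  have finS: "finite S" using finite_step_supp by (simp add: S_def)
  have "complex_of_real (\<integral>\<theta>. norm (walk_char \<theta> ^ k) ^ 2 \<partial>torus)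
     = (\<integral>\<theta>. (\<Sum>z\<in>S. \<Sum>w\<in>S. complex_of_real (step_pow p k z * step_pow p k w) * cis (inner_angle (z - w) \<theta>)) \<partial>torus)"
    unfolding S_def norm_walk_char_power[symmetric] by (rule integral_complex_of_real[symmetric])
  also have "\<dots> = (\<Sum>z\<in>S. \<Sum>w\<in>S. complex_of_real (step_pow p k z * step_pow p k w) * (if z - w = 0 then (2 * pi) ^ CARD('d) else 0))"
  proof -
    have i: "integrable torus (\<lambda>\<theta>. complex_of_real c * cis (inner_angle z \<theta>))" for c and z :: "int ^ 'd"
      by (rule F.integrable_const_bound[where B = "\<bar>c\<bar>"]) (auto simp: norm_mult)
    show ?thesis
      by (simp add: Bochner_Integration.integral_sum i integral_torus_character del: of_real_mult)
  qed
  also have "\<dots> = complex_of_real ((2 * pi) ^ CARD('d) * collision k)"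
  proof -
    have "(\<Sum>w\<in>S. complex_of_real (step_pow p k z * step_pow p k w) * (if z - w = 0 then (2 * pi) ^ CARD('d) else 0))
        = complex_of_real ((2 * pi) ^ CARD('d) * (step_pow p k z)\<^sup>2)" if "z \<in> S" for z
    proof -
      have "(\<Sum>w\<in>S. complex_of_real (step_pow p k z * step_pow p k w) * (if z - w = 0 then (2 * pi) ^ CARD('d) else 0))
        = (\<Sum>w\<in>S. if z = w then complex_of_real ((2 * pi) ^ CARD('d) * (step_pow p k z)\<^sup>2) else 0)"
        by (rule sum.cong) (auto simp: power2_eq_square)
      then show ?thesis using finS that by simp
    qed
    then show ?thesis
      by (simp add: collision_def S_def[symmetric] sum_distrib_left del: of_real_mult of_real_power)
  qed
  finally have "(\<integral>\<theta>. norm (walk_char \<theta> ^ k) ^ 2 \<partial>torus) = (2 * pi) ^ CARD('d) * collision k"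
    by (simp only: of_real_eq_iff)
  then show ?thesis
    by (simp add: norm_power power_mult[symmetric] mult.commute[of k 2])
qed

text \<open>The squared modulus is the characteristic function of the difference of two independent
  steps. All summands on the right are nonnegative, so any single one bounds the left side from
  below.\<close>

lemma one_minus_norm_walk_char:
  "1 - norm (walk_char \<theta>) ^ 2 =
    (\<Sum>y | p y \<noteq> 0. \<Sum>z | p z \<noteq> 0. p y * p z * (1 - cos (inner_angle (y - z) \<theta>)))"
proof -
  define S where "S = {y. p y \<noteq> 0}"
  have "complex_of_real (norm (walk_char \<theta>) ^ 2) =
      (\<Sum>y\<in>S. \<Sum>z\<in>S. complex_of_real (p y * p z) * cis (inner_angle (y - z) \<theta>))"
    unfolding complex_norm_square walk_char_def S_def
    by (simp add: sum_product inner_angle_diff cis_divide[symmetric] cis_cnj scaleR_conv_of_real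
      divide_inverse mult_ac flip: cis_inverse)
  from arg_cong[where f = Re, OF this]
  have "norm (walk_char \<theta>) ^ 2 = (\<Sum>y\<in>S. \<Sum>z\<in>S. p y * p z * cos (inner_angle (y - z) \<theta>))"
    by (simp del: of_real_mult of_real_power)
  moreover have "(\<Sum>y\<in>S. \<Sum>z\<in>S. p y * p z) = 1"
    using p_total by (simp add: sum_product[symmetric] S_def)
  ultimately show ?thesis
    by (simp add: S_def[symmetric] right_diff_distrib sum_subtractf)
qed

text \<open>The vectors \<open>v\<close> for which \<open>1 - cos (v \<bullet> \<theta>)\<close> is dominated by \<open>1 - \<bar>\<phi>(\<theta>)\<bar>\<^sup>2\<close> form a subgroup
  containing all differences of support points, hence all unit vectors by strong aperiodicity.\<close>

lemma spectral_gap: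
  assumes aper: "strongly_aperiodic p"
  shows "\<exists>c>0. \<forall>\<theta>. c * (\<Sum>i\<in>UNIV. 1 - cos (\<theta> i)) \<le> 1 - norm (walk_char \<theta>) ^ 2"
proof -
  define S where "S = {y. p y \<noteq> 0}"
  have fS: "finite S" using finite_supp by (simp add: S_def)
  define G where "G = {v. \<exists>C. \<forall>\<theta>. 1 - cos (inner_angle v \<theta>) \<le> C * (1 - norm (walk_char \<theta>) ^ 2)}"
  obtain x0 where x0: "p x0 > 0"
  proof -
    have "\<exists>x. p x \<noteq> 0"
    proof (rule ccontr)
      assume "\<not> ?thesis" then show False using p_total by simp
    qed
    then show ?thesis using that p_nonneg by (metis order_le_less)
  qed
  have gen: "x - x0 \<in> G" if x: "p x > 0" for x
  proof -
    \<comment> \<open>Keeping only the pair \<open>(x, x0)\<close> of the double sum produces this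
      constant.\<close>
    have "1 - cos (inner_angle (x - x0) \<theta>) \<le> (1 / (p x * p x0)) * (1 - norm (walk_char \<theta>) ^ 2)" for \<theta>
    proof -
      have nn: "0 \<le> p y * p z * (1 - cos (inner_angle (y - z) \<theta>))" for y z
        using p_nonneg by simp
      have "p x * p x0 * (1 - cos (inner_angle (x - x0) \<theta>)) \<le>
          (\<Sum>z\<in>S. p x * p z * (1 - cos (inner_angle (x - z) \<theta>)))"
        using x0 by (intro member_le_sum[of x0] fS nn) (auto simp: S_def)
      also have "\<dots> \<le> (\<Sum>y\<in>S. \<Sum>z\<in>S. p y * p z * (1 - cos (inner_angle (y - z) \<theta>)))"
        using x by (intro member_le_sum[of x S "\<lambda>y. \<Sum>z\<in>S. p y * p z * (1 - cos (inner_angle (y - z) \<theta>))"] fS sum_nonneg nn) (auto simp: S_def)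
      finally show ?thesis
        using x x0 by (simp add: one_minus_norm_walk_char S_def field_simps)
    qed
    then show ?thesis unfolding G_def by blast
  qed
  have le1: "0 \<le> 1 - norm (walk_char \<theta>) ^ 2" for \<theta>
    unfolding one_minus_norm_walk_char by (intro sum_nonneg mult_nonneg_nonneg p_nonneg) simp
  \<comment> \<open>Strong aperiodicity will be used with \<open>u = - x0\<close>, which turns the
    translated support into differences.\<close>
  have "add_subgroup_gen {- x0 + x |x. p x > 0} \<subseteq> G"
    unfolding add_subgroup_gen_def
  proof (rule Inter_lower, safe)
    show "0 \<in> G" unfolding G_def by (auto simp: inner_angle_0 intro!: exI[of _ 0])
    fix a b assume "a \<in> G" "b \<in> G"
    then obtain A B where A: "\<And>\<theta>. 1 - cos (inner_angle a \<theta>) \<le> A * (1 - norm (walk_char \<theta>) ^ 2)"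
      and B: "\<And>\<theta>. 1 - cos (inner_angle b \<theta>) \<le> B * (1 - norm (walk_char \<theta>) ^ 2)"
      unfolding G_def by blast
    show "- a \<in> G" using A by (auto simp: G_def inner_angle_minus)
    have "1 - cos (inner_angle (a + b) \<theta>) \<le> (2 * A + 2 * B) * (1 - norm (walk_char \<theta>) ^ 2)" for \<theta>
      using one_minus_cos_add[of "inner_angle a \<theta>" "inner_angle b \<theta>"] A[of \<theta>] B[of \<theta>]
      by (simp add: inner_angle_add distrib_right)
    then show "a + b \<in> G" unfolding G_def by blast
  next
    fix x assume "p x > 0"
    then show "- x0 + x \<in> G" using gen by simp
  qed
  moreover have "add_subgroup_gen {- x0 + x |x. p x > 0} = UNIV"
    using aper unfolding strongly_aperiodic_def by blast
  ultimately have "G = UNIV" by auto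
  then have "axis i 1 \<in> G" for i by simp
  then have "\<exists>C. \<forall>\<theta>. 1 - cos (\<theta> i) \<le> C * (1 - norm (walk_char \<theta>) ^ 2)" for i
    by (simp add: G_def inner_angle_axis)
  then obtain C where C: "\<And>i \<theta>. 1 - cos (\<theta> i) \<le> C i * (1 - norm (walk_char \<theta>) ^ 2)"
    by metis
  \<comment> \<open>The sum dominates all constants together, and the added 1 keeps \<open>K\<close>
    positive for the division.\<close>
  define K where "K = 1 + (\<Sum>i\<in>UNIV. \<bar>C i\<bar>)"
  have K: "K > 0" by (simp add: K_def add_pos_nonneg sum_nonneg)
  have "(1 / K) * (\<Sum>i\<in>UNIV. 1 - cos (\<theta> i)) \<le> 1 - norm (walk_char \<theta>) ^ 2" for \<theta>
  proof -
    have "(\<Sum>i\<in>UNIV. 1 - cos (\<theta> i)) \<le> (\<Sum>i\<in>UNIV. C i * (1 - norm (walk_char \<theta>) ^ 2))"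
      by (intro sum_mono C)
    also have "\<dots> \<le> K * (1 - norm (walk_char \<theta>) ^ 2)"
      unfolding sum_distrib_right[symmetric]
    proof (intro mult_right_mono le1)
      have "sum C UNIV \<le> (\<Sum>i\<in>UNIV. \<bar>C i\<bar>)" by (intro sum_mono) auto
      then show "sum C UNIV \<le> K" by (simp add: K_def)
    qed
    finally show ?thesis using K by (simp add: field_simps)
  qed
  then show ?thesis using K by (intro exI[of _ "1 / K"]) auto
qed

text \<open>With \<open>1 + u \<le> exp u\<close> the spectral gap bounds the integrand in
  Parseval's identity by a product of one-variable functions. Each circle integral then contributes
  a factor of order \<open>sqrt (1 / k)\<close>.\<close>

lemma collision_upper_bound:
  assumes aper: "strongly_aperiodic p"
  shows "\<exists>C. \<forall>k\<ge>1. collision k \<le> C * sqrt (1 / k) ^ CARD('d)"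
proof -
  interpret product_sigma_finite "\<lambda>_::'d. circle_measure" by (rule product_sigma_finite_circle)
  interpret F: finite_measure "torus :: ('d \<Rightarrow> real) measure" by (rule finite_measure_torus)
  obtain c where c: "c > 0"
    and gap: "\<And>\<theta>. c * (\<Sum>i\<in>UNIV. 1 - cos (\<theta> i)) \<le> 1 - norm (walk_char \<theta>) ^ 2"
    using spectral_gap[OF aper] by blast
  define C where "C = sqrt (20 * pi / c) ^ CARD('d)"
  have "collision k \<le> C * sqrt (1 / k) ^ CARD('d)" if k: "k \<ge> 1" for k :: nat
  proof -
    have kc: "k * c > 0" using c k by simp
    have pt: "norm (walk_char \<theta>) ^ (2 * k) \<le> (\<Prod>i\<in>UNIV. exp (- (k * c) * (1 - cos (\<theta> i))))" for \<theta>
    proof -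
      have "norm (walk_char \<theta>) ^ (2 * k) = (norm (walk_char \<theta>) ^ 2) ^ k"
        by (simp add: power_mult)
      also have "\<dots> \<le> exp (- c * (\<Sum>i\<in>UNIV. 1 - cos (\<theta> i))) ^ k"
        using gap[of \<theta>] exp_ge_add_one_self[of "- c * (\<Sum>i\<in>UNIV. 1 - cos (\<theta> i))"]
        by (intro power_mono) auto
      also have "\<dots> = exp (\<Sum>i\<in>UNIV. - (k * c) * (1 - cos (\<theta> i)))"
        by (simp add: exp_of_nat_mult[symmetric] sum_distrib_left[symmetric] mult.assoc sum_negf)
      finally show ?thesis by (simp add: exp_sum)
    qed
    have i1: "integrable torus (\<lambda>\<theta>. \<Prod>i\<in>(UNIV :: 'd set). exp (- (k * c) * (1 - cos (\<theta> i))))"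
      using kc by (intro F.integrable_const_bound[where B = 1])
        (auto simp: abs_prod intro!: prod_le_1 mult_nonneg_nonneg)
    have "(2 * pi) ^ CARD('d) * collision k = (\<integral>\<theta>. norm (walk_char \<theta>) ^ (2 * k) \<partial>torus)"
      by (rule collision_eq_integral)
    also have "\<dots> \<le> (\<integral>\<theta>. (\<Prod>i\<in>(UNIV :: 'd set). exp (- (k * c) * (1 - cos (\<theta> i)))) \<partial>torus)"
      by (rule integral_mono'[OF i1 pt]) (auto intro: prod_nonneg)
    also have "\<dots> = (\<Prod>i\<in>(UNIV :: 'd set). \<integral>x. exp (- (k * c) * (1 - cos x)) \<partial>circle_measure)"
      using kc by (intro product_integral_prod[of UNIV "\<lambda>i x. exp (- (k * c) * (1 - cos x))"] integrable_circle_bounded[of _ 1])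
        (auto simp: mult_nonneg_nonneg)
    also have "\<dots> \<le> (\<Prod>i\<in>(UNIV :: 'd set). sqrt (20 * pi / (k * c)))"
      by (intro prod_mono conjI integral_circle_exp_cos kc) (auto intro!: integral_nonneg)
    also have "\<dots> = C * sqrt (1 / k) ^ CARD('d)"
      by (simp add: C_def real_sqrt_divide power_mult_distrib real_sqrt_mult field_simps power_divide)
    finally have "(2 * pi) ^ CARD('d) * collision k \<le> C * sqrt (1 / k) ^ CARD('d)" .
    moreover have "1 \<le> (2 * pi) ^ CARD('d)"
      using pi_gt3 by (intro one_le_power) simp
    ultimately show ?thesis
      using mult_right_mono[of 1 "(2 * pi) ^ CARD('d)" "collision k"] collision_nonneg[of k] by linarith
  qed
  then show ?thesis by blast
qed

lemma collision_summable:
  assumes aper: "strongly_aperiodic p" and dim: "3 \<le> CARD('d)"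
  shows "summable collision"
proof -
  obtain C where C: "\<And>k. k \<ge> 1 \<Longrightarrow> collision k \<le> C * sqrt (1 / k) ^ CARD('d)"
    using collision_upper_bound[OF aper] by blast
  have C0: "C \<ge> 0" using C[of 1] collision_nonneg[of 1] by simp
  have "summable (\<lambda>k. C * real k powr (- 3 / 2))"
    by (intro summable_mult) (simp add: summable_real_powr_iff)
  then show ?thesis
  proof (rule summable_comparison_test'[where N = 1])
    fix k :: nat assume k: "k \<ge> 1"
    \<comment> \<open>The base is at most 1, so higher dimensions reduce to three, where the
      exponent -3/2 is summable.\<close>
    have "sqrt (1 / k) ^ CARD('d) \<le> sqrt (1 / k) ^ 3"
      using k dim by (intro power_decreasing) auto
    also have sq: "sqrt (1 / k) = real k powr (- 1 / 2)"
      using k by (simp add: powr_minus_divide powr_half_sqrt real_sqrt_divide)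
    also have "(real k powr (- 1 / 2)) ^ 3 = real k powr (- 3 / 2)"
      using k by (simp add: powr_power)
    finally have "sqrt (1 / k) ^ CARD('d) \<le> real k powr (- 3 / 2)" by (simp only: sq)
    then show "norm (collision k) \<le> C * real k powr (- 3 / 2)"
      using order_trans[OF C[OF k] mult_left_mono[OF _ C0]] collision_nonneg[of k] by simp
  qed
qed

end

section \<open>Absence of invariant distributions in low dimension\<close>

text \<open>The second-order expansion of \<open>char \<mu>\<close> at 0 has main term
  \<open>1 - u\<^sup>2 * v / 2\<close>. Close to 0 the error consumes at most half of the quadratic
  term, and \<open>1 + x \<le> exp x\<close> finishes.\<close>

lemma char_gaussian_bound:
  fixes \<mu> :: "real measure"
  assumes mu: "prob_space \<mu>" "sets \<mu> = sets borel"
    and sq: "integrable \<mu> (\<lambda>r. r\<^sup>2)" and mean: "(\<integral>r. r \<partial>\<mu>) = 0" and var: "(\<integral>r. r\<^sup>2 \<partial>\<mu>) > 0"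
  shows "\<exists>c>0. \<exists>\<delta>>0. \<forall>u. \<bar>u\<bar> \<le> \<delta> \<longrightarrow> norm (char \<mu> u) \<le> exp (- c * u\<^sup>2)"
proof -
  interpret prob_space \<mu> by fact
  have sp: "space \<mu> = UNIV" using sets_eq_imp_space_eq[OF mu(2)] by simp
  interpret real_distribution \<mu>
    by unfold_locales (use mu sp in auto)
  define v where "v = (\<integral>r. r\<^sup>2 \<partial>\<mu>)"
  have v: "v > 0" using var by (simp add: v_def)
  have int1: "integrable \<mu> (\<lambda>r. r)"
    by (rule square_integrable_imp_integrable[OF _ sq]) (use mu in simp)
  \<comment> \<open>\<open>f\<close> is the remainder factor of \<open>char_approx3\<close>. It
    tends to 0 by dominated convergence with bound \<open>6 * x\<^sup>2\<close>, and its
    monotonicity makes one threshold serve all smaller arguments.\<close>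
  define f where "f t = (\<integral>x. min (6 * x\<^sup>2) (\<bar>t\<bar> * \<bar>x\<bar> ^ 3) \<partial>\<mu>)" for t :: real
  have fint: "integrable \<mu> (\<lambda>x. min (6 * x\<^sup>2) (\<bar>t\<bar> * \<bar>x\<bar> ^ 3))" for t :: real
    by (rule Bochner_Integration.integrable_bound[OF integrable_mult_right[OF sq, of 6]]) (use mu in auto)
  have fmono: "f s \<le> f t" if "\<bar>s\<bar> \<le> \<bar>t\<bar>" for s t
    unfolding f_def by (intro integral_mono fint min.mono mult_right_mono that) auto
  have seq: "(\<lambda>n. 1 / real (Suc n)) \<longlonglongrightarrow> 0"
    using LIMSEQ_inverse_real_of_nat by (simp add: inverse_eq_divide)
  have "(\<lambda>n. f (1 / real (Suc n))) \<longlonglongrightarrow> (\<integral>x. 0 \<partial>\<mu>)"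
    unfolding f_def
  proof (rule integral_dominated_convergence[where w = "\<lambda>x. 6 * x\<^sup>2"])
    have "(\<lambda>n. min (6 * x\<^sup>2) (\<bar>1 / real (Suc n)\<bar> * \<bar>x\<bar> ^ 3)) \<longlonglongrightarrow> min (6 * x\<^sup>2) (\<bar>0\<bar> * \<bar>x\<bar> ^ 3)" for x :: real
      by (intro tendsto_intros seq)
    moreover have "min (6 * x\<^sup>2) (\<bar>0\<bar> * \<bar>x\<bar> ^ 3) = 0" for x :: real by simp
    ultimately show "AE x in \<mu>. (\<lambda>n. min (6 * x\<^sup>2) (\<bar>1 / real (Suc n)\<bar> * \<bar>x\<bar> ^ 3)) \<longlonglongrightarrow> 0"
      by (intro AE_I2) metis
  qed (use mu sq in auto)
  then have "eventually (\<lambda>n. f (1 / real (Suc n)) < 3 / 2 * v) sequentially"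
    using v by (intro order_tendstoD(2)[of _ 0]) auto
  moreover have "(\<lambda>n. (1 / real (Suc n))\<^sup>2 * v) \<longlonglongrightarrow> 0\<^sup>2 * v"
    by (intro tendsto_intros seq)
  then have "eventually (\<lambda>n. (1 / real (Suc n))\<^sup>2 * v < 2) sequentially"
    by (rule order_tendstoD(2)) simp
  \<comment> \<open>The first threshold makes the error at most \<open>u\<^sup>2 * v / 4\<close>;
    the second keeps \<open>1 - u\<^sup>2 * v / 2\<close> nonnegative, hence equal to its own
    modulus.\<close>
  ultimately obtain n where n: "f (1 / real (Suc n)) < 3 / 2 * v" "(1 / real (Suc n))\<^sup>2 * v < 2"
    using eventually_happens'[OF sequentially_bot eventually_conj] by blast
  define \<delta> where "\<delta> = 1 / real (Suc n)"
  have "norm (char \<mu> u) \<le> exp (- (v / 4) * u\<^sup>2)" if u: "\<bar>u\<bar> \<le> \<delta>" for u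
  proof -
    have "f u \<le> f \<delta>" using u by (intro fmono) auto
    then have fu: "f u \<le> 3 / 2 * v" using n by (simp add: \<delta>_def)
    have "u\<^sup>2 \<le> \<delta>\<^sup>2" using u abs_le_square_iff[of u \<delta>] by simp
    then have "u\<^sup>2 * v \<le> \<delta>\<^sup>2 * v" using v by (intro mult_right_mono) auto
    then have uv: "u\<^sup>2 * v \<le> 2" using n by (simp add: \<delta>_def)
    have "norm (char \<mu> u - (1 - u\<^sup>2 * v / 2)) \<le> u\<^sup>2 / 6 * f u"
      unfolding f_def using char_approx3[of v u] int1 mean sq by (simp add: v_def)
    also have "\<dots> \<le> u\<^sup>2 / 6 * (3 / 2 * v)"
      by (intro mult_left_mono fu) auto
    finally have "norm (char \<mu> u - complex_of_real (1 - u\<^sup>2 * v / 2)) \<le> u\<^sup>2 * v / 4"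
      by (simp add: mult.commute)
    moreover have "norm (complex_of_real (1 - u\<^sup>2 * v / 2)) = 1 - u\<^sup>2 * v / 2"
      unfolding norm_of_real using uv by simp
    ultimately have "norm (char \<mu> u) \<le> 1 + (- (v / 4) * u\<^sup>2)"
      using norm_triangle_sub[of "char \<mu> u" "complex_of_real (1 - u\<^sup>2 * v / 2)"] by (simp add: mult.commute)
    also have "\<dots> \<le> exp (- (v / 4) * u\<^sup>2)" by (rule exp_ge_add_one_self)
    finally show ?thesis .
  qed
  then show ?thesis
    using v by (intro exI[of _ "v / 4"] conjI exI[of _ \<delta>]) (auto simp: \<delta>_def)
qed

lemma
  fixes \<mu> :: "real measure"
  assumes mu: "prob_space \<mu>" "sets \<mu> = sets borel"
  shows indep_vars_iid_coordinates:
      "prob_space.indep_vars (PiM UNIV (\<lambda>_. \<mu>)) (\<lambda>_. borel) (\<lambda>i w. w i) UNIV" (is ?ind)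
    and distr_iid_coordinate: "distr (PiM UNIV (\<lambda>_. \<mu>)) borel (\<lambda>w. w i) = \<mu>" (is ?dis)
proof -
  interpret P: prob_space "PiM UNIV (\<lambda>_. \<mu>)" by (intro prob_space_PiM mu)
  have c: "distr (PiM UNIV (\<lambda>_. \<mu>)) borel (\<lambda>w. w i) = \<mu>" for i
  proof -
    have "distr (PiM UNIV (\<lambda>_. \<mu>)) borel (\<lambda>w. w i) = distr (PiM UNIV (\<lambda>_. \<mu>)) \<mu> (\<lambda>w. w i)"
      by (rule distr_cong) (simp_all add: mu)
    also have "\<dots> = \<mu>" using mu by (intro distr_PiM_component) auto
    finally show ?thesis .
  qed
  show ?dis by (rule c)
  have m: "(\<lambda>w. w i) \<in> borel_measurable (PiM UNIV (\<lambda>_. \<mu>))" for i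
    using measurable_component_singleton[of i UNIV "\<lambda>_. \<mu>"] mu by (simp cong: measurable_cong_sets)
  \<comment> \<open>The independence criterion compares laws on a product of \<open>borel\<close>
    spaces. As \<open>\<mu>\<close> has the same measurable sets, the identity map supplies the
    comparison.\<close>
  have "distr (PiM UNIV (\<lambda>_. \<mu>)) (PiM UNIV (\<lambda>_. borel)) (\<lambda>x. x) = PiM UNIV (\<lambda>_. \<mu>)"
    by (rule distr_id2) (rule sets_PiM_cong; simp add: mu)
  then show ?ind
    by (subst P.indep_vars_iff_distr_eq_PiM') (auto simp: m c restrict_UNIV)
qed

lemma distr_pair_measure_snd:
  assumes "prob_space M" "prob_space N"
  shows "distr (M \<Otimes>\<^sub>M N) N snd = N"
proof -
  interpret M: prob_space M by fact
  interpret N: prob_space N by fact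
  show ?thesis
  proof (rule measure_eqI)
    fix A assume A: "A \<in> sets (distr (M \<Otimes>\<^sub>M N) N snd)"
    then have "snd -` A \<inter> space (M \<Otimes>\<^sub>M N) = space M \<times> A"
      using sets.sets_into_space[of A N] by (auto simp: space_pair_measure)
    then show "emeasure (distr (M \<Otimes>\<^sub>M N) N snd) A = emeasure N A"
      using A by (simp add: emeasure_distr N.emeasure_pair_measure_Times M.emeasure_space_1)
  qed simp
qed

lemma indep_var_fst_snd:
  fixes M1 M2 :: "'a measure"
  assumes "prob_space M1" "prob_space M2"
  shows "prob_space.indep_var (M1 \<Otimes>\<^sub>M M2) M1 fst M2 snd"
proof -
  interpret M1: prob_space M1 by fact
  interpret M2: prob_space M2 by fact
  interpret pair_prob_space M1 M2 ..
  have "distr (M1 \<Otimes>\<^sub>M M2) M1 fst = M1"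
    by (rule M2.distr_pair_fst)
  moreover have "distr (M1 \<Otimes>\<^sub>M M2) M2 snd = M2"
    by (rule distr_pair_measure_snd[OF assms])
  ultimately show ?thesis
    by (subst P.indep_var_distribution_eq) (auto simp: distr_id)
qed

lemma measurable_state_component [measurable]: "(\<lambda>h. h x) \<in> borel_measurable state_space"
  unfolding state_space_def by simp

lemma space_state_space [simp]: "space state_space = UNIV"
  by (simp add: state_space_def space_PiM)

lemma sets_iid_state_space:
  assumes "sets \<mu> = sets borel"
  shows "sets (PiM UNIV (\<lambda>_. \<mu>)) = sets state_space"
  unfolding state_space_def by (rule sets_PiM_cong) (simp_all add: assms)

lemma measurable_height_step:
  "(\<lambda>(h, e). height_step p h e) \<in> measurable (state_space \<Otimes>\<^sub>M state_space) state_space"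
  by (subst (3) state_space_def, rule measurable_PiM_single')
    (auto simp: height_step_def avg_def case_prod_beta)

lemma measurable_height_step_iid:
  assumes "sets \<mu> = sets borel" "sets \<nu> = sets state_space"
  shows "(\<lambda>(h, e). height_step p h e) \<in> measurable (\<nu> \<Otimes>\<^sub>M PiM UNIV (\<lambda>_. \<mu>)) state_space"
proof -
  have "sets (\<nu> \<Otimes>\<^sub>M PiM UNIV (\<lambda>_. \<mu>)) = sets (state_space \<Otimes>\<^sub>M state_space)"
    by (intro sets_pair_measure_cong sets_iid_state_space assms)
  then show ?thesis using measurable_height_step measurable_cong_sets[OF _ refl] by blast
qed

section \<open>Characteristic functions under an invariant law\<close>

context finite_range_walk
begin

lemma avg_eq: "avg p h x = (\<Sum>y | p y \<noteq> 0. p y * h (x + y))"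
proof -
  have "{y. p (y - x) \<noteq> 0} = (\<lambda>y. x + y) ` {y. p y \<noteq> 0}"
    by (auto simp: image_iff) (metis add_diff_cancel_left' diff_add_cancel add.commute)
  then show ?thesis by (simp add: avg_def sum.reindex)
qed

text \<open>One application of the averaging dynamics raises the observation index by one, which
  drives the recursion for the characteristic functions.\<close>

lemma walk_sum_avg: "walk_sum k (avg p h) = walk_sum (Suc k) h"
  unfolding walk_sum_Suc unfolding walk_sum_def avg_eq
  by (simp add: sum_distrib_left, subst sum.swap) (simp add: algebra_simps)

lemma step_le_1: "step_pow p k z \<le> 1"
proof (cases "step_pow p k z = 0")
  case False
  then have "step_pow p k z \<le> (\<Sum>z | step_pow p k z \<noteq> 0. step_pow p k z)"
    using finite_step_supp step_nonneg by (intro member_le_sum) auto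
  also have "\<dots> = 1" using walk_sum_const[of k 1] unfolding walk_sum_def by simp
  finally show ?thesis .
qed simp

lemma measurable_walk_sum [measurable]: "walk_sum k \<in> borel_measurable state_space"
  unfolding walk_sum_def by measurable

text \<open>After one update the observable splits into an observable of the old heights and a
  linear combination of fresh noise. The two are independent, so characteristic functions multiply,
  and the noise part factors over sites.\<close>

lemma invariant_char_step:
  assumes inv: "invariant_distribution p \<mu> \<nu>" and mu: "prob_space \<mu>" "sets \<mu> = sets borel"
  shows "char (distr \<nu> borel (walk_sum k)) s =
     char (distr \<nu> borel (walk_sum (Suc k))) s * (\<Prod>z | step_pow p k z \<noteq> 0. char \<mu> (s * step_pow p k z))"
proof -
  define E where "E = PiM UNIV (\<lambda>_ :: int ^ 'd. \<mu>)"
  have nu: "prob_space \<nu>" "sets \<nu> = sets state_space"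
    and eq: "distr (\<nu> \<Otimes>\<^sub>M E) state_space (\<lambda>(h, e). height_step p h e) = \<nu>"
    using inv by (auto simp: invariant_distribution_def E_def)
  interpret nu: prob_space \<nu> by fact
  interpret E: prob_space E unfolding E_def by (intro prob_space_PiM mu)
  interpret pair_prob_space \<nu> E ..
  have setsE: "sets E = sets state_space" unfolding E_def by (rule sets_iid_state_space[OF mu(2)])
  have mE[measurable]: "walk_sum j \<in> borel_measurable E" and mnu[measurable]: "walk_sum j \<in> borel_measurable \<nu>" for j
    using measurable_walk_sum[of j] by (simp_all add: setsE nu(2) cong: measurable_cong_sets)
  have mh[measurable]: "(\<lambda>(h, e). height_step p h e) \<in> measurable (\<nu> \<Otimes>\<^sub>M E) state_space"
    unfolding E_def by (rule measurable_height_step_iid[OF mu(2) nu(2)])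
  \<comment> \<open>Invariance is applied to the left side alone, replacing \<open>\<nu>\<close> by
    its image under one update.\<close>
  have "distr \<nu> borel (walk_sum k) = distr (\<nu> \<Otimes>\<^sub>M E) borel (walk_sum k \<circ> (\<lambda>(h, e). height_step p h e))"
    by (subst (1) eq[symmetric], rule distr_distr) measurable
  also have "walk_sum k \<circ> (\<lambda>(h, e). height_step p h e) = (\<lambda>\<omega>. (walk_sum (Suc k) \<circ> fst) \<omega> + (walk_sum k \<circ> snd) \<omega>)"
    by (auto simp: fun_eq_iff height_step_def walk_sum_add walk_sum_avg)
  also have "char (distr (\<nu> \<Otimes>\<^sub>M E) borel \<dots>) s = char (distr (\<nu> \<Otimes>\<^sub>M E) borel (walk_sum (Suc k) \<circ> fst)) s
       * char (distr (\<nu> \<Otimes>\<^sub>M E) borel (walk_sum k \<circ> snd)) s"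
    by (intro P.char_distr_add P.indep_var_compose[OF indep_var_fst_snd[OF nu(1) E.prob_space_axioms]]) measurable
  also have "distr (\<nu> \<Otimes>\<^sub>M E) borel (walk_sum (Suc k) \<circ> fst) = distr \<nu> borel (walk_sum (Suc k))"
    by (subst distr_distr[of _ \<nu>, symmetric]) (auto simp: E.distr_pair_fst)
  also have "distr (\<nu> \<Otimes>\<^sub>M E) borel (walk_sum k \<circ> snd) = distr E borel (walk_sum k)"
    by (subst distr_distr[of _ E, symmetric]) (auto simp: distr_pair_measure_snd nu.prob_space_axioms E.prob_space_axioms)
  also have "char (distr E borel (walk_sum k)) s = (\<Prod>z | step_pow p k z \<noteq> 0. char \<mu> (s * step_pow p k z))"
  proof -
    have ind: "E.indep_vars (\<lambda>_. borel) (\<lambda>z w. step_pow p k z * w z) {z. step_pow p k z \<noteq> 0}"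
    proof -
      have "E.indep_vars (\<lambda>_. borel) (\<lambda>z w. w z) UNIV"
        unfolding E_def by (rule indep_vars_iid_coordinates[OF mu])
      from E.indep_vars_compose2[OF this, of "\<lambda>z x. step_pow p k z * x" "\<lambda>_. borel"]
      show ?thesis by (auto intro: E.indep_vars_subset)
    qed
    have one: "char (distr E borel (\<lambda>w. c * w z)) s = char \<mu> (s * c)" for c z
    proof -
      have mz[measurable]: "(\<lambda>w. w z) \<in> borel_measurable E"
        using measurable_state_component[of z] by (simp add: setsE cong: measurable_cong_sets)
      have "char (distr E borel (\<lambda>w. c * w z)) s = (\<integral>w. iexp (s * (c * w z)) \<partial>E)"
        by (simp add: char_def integral_distr)
      also have "\<dots> = (\<integral>x. iexp (s * c * x) \<partial>(distr E borel (\<lambda>w. w z)))"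
        by (subst integral_distr) (simp_all add: mult.assoc)
      also have "distr E borel (\<lambda>w. w z) = \<mu>"
        unfolding E_def by (rule distr_iid_coordinate[OF mu])
      finally show ?thesis by (simp add: char_def)
    qed
    show ?thesis
      using E.char_distr_sum[OF ind, of s] by (simp add: one walk_sum_def[abs_def])
  qed
  finally show ?thesis .
qed

theorem no_invariant_distribution:
  assumes dim: "CARD('d) \<le> 2"
    and mu: "prob_space \<mu>" "sets \<mu> = sets borel"
    and sq: "integrable \<mu> (\<lambda>r. r\<^sup>2)" and mean: "(\<integral>r. r \<partial>\<mu>) = 0" and var: "(\<integral>r. r\<^sup>2 \<partial>\<mu>) > 0"
  shows "\<not> invariant_distribution p \<mu> \<nu>"
proof
  assume inv: "invariant_distribution p \<mu> \<nu>"
  then have nu: "prob_space \<nu>" "sets \<nu> = sets state_space" by (auto simp: invariant_distribution_def)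
  interpret nu: prob_space \<nu> by fact
  obtain c \<delta> where c: "c > 0" and \<delta>: "\<delta> > 0"
    and gauss: "\<And>u. \<bar>u\<bar> \<le> \<delta> \<Longrightarrow> norm (char \<mu> u) \<le> exp (- c * u\<^sup>2)"
    using char_gaussian_bound[OF mu sq mean var] by blast
  define \<phi> where "\<phi> k s = char (distr \<nu> borel (walk_sum k)) s" for k s
  have rd: "real_distribution (distr \<nu> borel (walk_sum k))" for k
    using measurable_walk_sum[of k] by (intro nu.real_distribution_distr) (simp add: nu(2) cong: measurable_cong_sets)
  have zero: "\<phi> 0 s = 0" if s: "\<bar>s\<bar> \<le> \<delta>" "s \<noteq> 0" for s
  proof (rule ccontr)
    assume ne: "\<phi> 0 s \<noteq> 0"
    have bd: "norm (\<phi> k s) \<le> norm (\<phi> (Suc k) s) * exp (- c * s\<^sup>2 * collision k)" for k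
    proof -
      have "norm (\<phi> k s) = norm (\<phi> (Suc k) s) * (\<Prod>z | step_pow p k z \<noteq> 0. norm (char \<mu> (s * step_pow p k z)))"
        unfolding \<phi>_def by (subst invariant_char_step[OF inv mu]) (simp add: norm_mult prod_norm)
      also have "\<dots> \<le> norm (\<phi> (Suc k) s) * (\<Prod>z | step_pow p k z \<noteq> 0. exp (- c * (s * step_pow p k z)\<^sup>2))"
      proof (intro mult_left_mono prod_mono conjI gauss)
        fix z
        \<comment> \<open>Transition probabilities are at most 1, so the Gaussian bound with the
          same \<open>\<delta>\<close> applies at every site and for every \<open>k\<close>.\<close>
        have "\<bar>s\<bar> * \<bar>step_pow p k z\<bar> \<le> \<bar>s\<bar> * 1"
          using step_le_1[of k z] step_nonneg[of k z] by (intro mult_left_mono) auto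
        then show "\<bar>s * step_pow p k z\<bar> \<le> \<delta>" using s(1) by (simp add: abs_mult)
      qed auto
      also have "(\<Prod>z | step_pow p k z \<noteq> 0. exp (- c * (s * step_pow p k z)\<^sup>2)) = exp (- c * s\<^sup>2 * collision k)"
        by (simp add: exp_sum[OF finite_step_supp, symmetric] collision_def sum_distrib_left power_mult_distrib mult.assoc sum_negf)
      finally show ?thesis .
    qed
    have "norm (\<phi> 0 s) \<le> norm (\<phi> n s) * exp (- c * s\<^sup>2 * (\<Sum>k<n. collision k))" for n
    proof (induction n)
      case (Suc n)
      have "norm (\<phi> n s) * exp (- c * s\<^sup>2 * (\<Sum>k<n. collision k))
        \<le> (norm (\<phi> (Suc n) s) * exp (- c * s\<^sup>2 * collision n)) * exp (- c * s\<^sup>2 * (\<Sum>k<n. collision k))"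
        by (intro mult_right_mono bd) simp
      also have "\<dots> = norm (\<phi> (Suc n) s) * exp (- c * s\<^sup>2 * (\<Sum>k<Suc n. collision k))"
        by (simp add: exp_add[symmetric] algebra_simps)
      finally show ?case using Suc by simp
    qed simp
    moreover have "norm (\<phi> n s) \<le> 1" for n
      unfolding \<phi>_def by (rule real_distribution.cmod_char_le_1[OF rd])
    ultimately have up: "norm (\<phi> 0 s) \<le> exp (- c * s\<^sup>2 * (\<Sum>k<n. collision k))" for n
      by (meson exp_ge_zero mult_left_le_one_le norm_ge_zero order_trans)
    \<comment> \<open>If the value at \<open>s\<close> were nonzero, taking logarithms would bound
      all partial sums, against the divergence in low dimension.\<close>
    have "(\<Sum>k<n. collision k) \<le> - ln (norm (\<phi> 0 s)) / (c * s\<^sup>2)" for n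
    proof -
      have "ln (norm (\<phi> 0 s)) \<le> - c * s\<^sup>2 * (\<Sum>k<n. collision k)"
        using up[of n] ne by (metis ln_exp ln_le_cancel_iff exp_gt_zero zero_less_norm_iff)
      then show ?thesis using c s by (simp add: field_simps)
    qed
    then have "summable collision"
      by (intro summableI_nonneg_bounded collision_nonneg)
    then show False using collision_not_summable[OF dim] by blast
  qed
  \<comment> \<open>Along these nonzero points tending to 0 the characteristic function vanishes,
    while its value at 0 is 1.\<close>
  have "(\<lambda>n. \<phi> 0 (\<delta> * inverse (real (Suc n)))) \<longlonglongrightarrow> \<phi> 0 (\<delta> * 0)"
    unfolding \<phi>_def
    by (rule isCont_tendsto_compose[OF real_distribution.isCont_char[OF rd]])
      (intro tendsto_intros LIMSEQ_inverse_real_of_nat)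
  moreover have "\<phi> 0 (\<delta> * inverse (real (Suc n))) = 0" for n
    using \<delta> by (intro zero) (auto simp: field_simps)
  moreover have "\<phi> 0 0 = 1"
    unfolding \<phi>_def by (rule real_distribution.char_zero[OF rd])
  ultimately show False by (simp add: LIMSEQ_const_iff)
qed

end

section \<open>Ergodicity of i.i.d. shifts\<close>

lemma distr_iid_reindex:
  assumes "prob_space \<mu>" "inj f"
  shows "distr (PiM UNIV (\<lambda>_. \<mu>)) (PiM UNIV (\<lambda>_. \<mu>)) (\<lambda>w i. w (f i)) = PiM UNIV (\<lambda>_. \<mu>)"
  using distr_PiM_reindex[of UNIV "\<lambda>_. \<mu>" f UNIV] assms by (simp add: restrict_UNIV)

lemma measurable_iid_reindex [measurable]:
  "(\<lambda>w i. w (f i)) \<in> measurable (PiM UNIV (\<lambda>_. \<mu>)) (PiM UNIV (\<lambda>_. \<mu>))"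
  by (rule measurable_PiM_single') (auto simp: space_PiM)

text \<open>A Dynkin system argument. Complements use that all \<open>D n\<close> have the same
  probability \<open>q\<close>; countable disjoint unions need the limit exchanged with a series,
  which Tannery's theorem permits since \<open>prob (A i)\<close> dominates the terms.\<close>

lemma (in prob_space) asymptotic_independence_extend:
  assumes G: "Int_stable G" "G \<subseteq> events"
    and D: "\<And>n. D n \<in> events" "\<And>n. prob (D n) = q"
    and basic: "\<And>A. A \<in> G \<Longrightarrow> (\<lambda>n. prob (A \<inter> D n)) \<longlonglongrightarrow> prob A * q"
    and A: "A \<in> sigma_sets (space M) G"
  shows "(\<lambda>n. prob (A \<inter> D n)) \<longlonglongrightarrow> prob A * q"
proof -
  have GP: "G \<subseteq> Pow (space M)" using G(2) sets.space_closed by blast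
  have sub: "sigma_sets (space M) G \<subseteq> events" using G(2) by (rule sets.sigma_sets_subset)
  show ?thesis
    using G(1) GP A
  proof (induction rule: sigma_sets_induct_disjoint)
    case (compl A)
    then have A: "A \<in> events" using sub by auto
    have "prob ((space M - A) \<inter> D n) = q - prob (A \<inter> D n)" for n
    proof -
      have "(space M - A) \<inter> D n = D n - A \<inter> D n" using sets.sets_into_space[OF D(1)[of n]] by blast
      then show ?thesis using A D by (simp add: finite_measure_Diff)
    qed
    moreover have "(\<lambda>n. q - prob (A \<inter> D n)) \<longlonglongrightarrow> q - prob A * q"
      by (intro tendsto_intros compl)
    ultimately show ?case using A by (simp add: prob_compl left_diff_distrib)
  next
    case (union A)
    then have A: "range A \<subseteq> events" using sub by auto
    have sums: "(\<lambda>i. prob (A i \<inter> D n)) sums prob ((\<Union>i. A i) \<inter> D n)" for n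
    proof -
      have "(\<lambda>i. prob (A i \<inter> D n)) sums prob (\<Union>i. A i \<inter> D n)"
        using union(1) A D by (intro finite_measure_UNION) (auto simp: disjoint_family_on_def)
      then show ?thesis by simp
    qed
    have sumA: "(\<lambda>i. prob (A i)) sums prob (\<Union>i. A i)"
      using union(1) A by (intro finite_measure_UNION) auto
    have "(\<lambda>n. \<Sum>i. prob (A i \<inter> D n)) \<longlonglongrightarrow> (\<Sum>i. prob (A i) * q)"
    proof (rule tannerys_theorem[where M = "\<lambda>i. prob (A i)", THEN conjunct2, THEN conjunct2])
      show "\<forall>\<^sub>F (k, n) in sequentially \<times>\<^sub>F sequentially. norm (prob (A k \<inter> D n)) \<le> prob (A k)"
        using A by (intro always_eventually) (auto intro!: finite_measure_mono)
    qed (use union(3) sumA in \<open>auto simp: sums_iff\<close>)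
    moreover have "(\<Sum>i. prob (A i) * q) = prob (\<Union>i. A i) * q"
      using sumA by (simp add: sums_iff suminf_mult2[symmetric])
    ultimately show ?case using sums by (simp add: sums_iff)
  qed (use basic in auto)
qed

text \<open>Shifts separate cylinder events until they are independent. Extending one of the two
  events from cylinders to the invariant \<open>B\<close> shows that \<open>B\<close> is independent
  of every cylinder, hence of itself.\<close>

theorem iid_shift_ergodic:
  fixes \<mu> :: "real measure" and \<tau> :: "'i \<Rightarrow> 'i"
  assumes mu: "prob_space \<mu>" "sets \<mu> = sets borel" and inj: "inj \<tau>"
    and escape: "\<And>i j. \<forall>\<^sub>F n in sequentially. (\<tau> ^^ n) i \<noteq> j"
    and B: "B \<in> sets (PiM UNIV (\<lambda>_. \<mu>))" "\<And>w. (\<lambda>i. w (\<tau> i)) \<in> B \<longleftrightarrow> w \<in> B"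
  shows "measure (PiM UNIV (\<lambda>_. \<mu>)) B \<in> {0, 1}"
proof -
  define P where "P = PiM UNIV (\<lambda>_ :: 'i. \<mu>)"
  interpret prob_space P unfolding P_def by (intro prob_space_PiM mu)
  have sp_mu: "space \<mu> = UNIV" using sets_eq_imp_space_eq[OF mu(2)] by simp
  have sp: "space P = UNIV" by (simp add: P_def space_PiM sp_mu)
  define T where "T n w = (\<lambda>i. w ((\<tau> ^^ n) i))" for n and w :: "'i \<Rightarrow> real"
  have inj_n: "inj (\<tau> ^^ n)" for n using inj by (induction n) (auto intro: inj_compose)
  have T: "T n \<in> measurable P P" for n
    unfolding T_def P_def by (rule measurable_iid_reindex)
  have T_pres: "prob (T n -` A) = prob A" if "A \<in> events" for n A
  proof -
    have dis: "distr P P (T n) = P"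
      unfolding T_def P_def by (rule distr_iid_reindex[OF mu(1) inj_n])
    have "measure (distr P P (T n)) A = prob (T n -` A \<inter> space P)"
      by (rule measure_distr[OF T that])
    then show ?thesis unfolding dis sp by simp
  qed
  have T_events: "T n -` A \<in> events" if "A \<in> events" for n A
    using measurable_sets[OF T that] by (simp add: sp)
  have TB: "T n -` B = B" for n
  proof (induction n)
    case (Suc n)
    have "T (Suc n) w = T n (\<lambda>i. w (\<tau> i))" for w by (simp add: T_def)
    then have "T (Suc n) w \<in> B \<longleftrightarrow> w \<in> B" for w
      using Suc B(2)[of w] by auto
    then show ?case by auto
  qed (auto simp: T_def)
  define G where "G = prod_algebra (UNIV :: 'i set) (\<lambda>_. \<mu>)"
  have G_stable: "Int_stable G" unfolding G_def by (rule Int_stable_prod_algebra)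
  have G_sigma: "sigma_sets (space P) G = events"
    unfolding G_def P_def by (simp add: sets_PiM space_PiM)
  have G_events: "G \<subseteq> events" using G_sigma by auto
  have G_box: "\<exists>J E. finite J \<and> (\<forall>j\<in>J. E j \<in> sets borel) \<and> A = {w. \<forall>j\<in>J. w j \<in> E j}" if "A \<in> G" for A
  proof -
    obtain J E where J: "finite J" "E \<in> (\<Pi> j\<in>J. sets \<mu>)" "A = prod_emb UNIV (\<lambda>_. \<mu>) J (\<Pi>\<^sub>E j\<in>J. E j)"
      using \<open>A \<in> G\<close> unfolding G_def prod_algebra_def by auto
    then have "A = {w. \<forall>j\<in>J. w j \<in> E j}"
      by (auto simp: prod_emb_def sp_mu PiE_iff)
    moreover have "\<forall>j\<in>J. E j \<in> sets borel" using J(2) by (auto simp: mu(2))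
    ultimately show ?thesis using J(1) by blast
  qed
  have coord: "indep_vars (\<lambda>_. borel) (\<lambda>i w. w i) UNIV"
    unfolding P_def by (rule indep_vars_iid_coordinates[OF mu])
  \<comment> \<open>After many shifts the coordinates fixing \<open>C\<close> are disjoint from those fixing \<open>A\<close>.\<close>
  have indep: "(\<lambda>n. prob (A \<inter> T n -` C)) \<longlonglongrightarrow> prob A * prob C" if A: "A \<in> G" and C: "C \<in> G" for A C
  proof -
    obtain J E where J: "finite J" "\<And>j. j \<in> J \<Longrightarrow> E j \<in> sets borel" "A = {w. \<forall>j\<in>J. w j \<in> E j}"
      using G_box[OF A] by blast
    obtain K F where K: "finite K" "\<And>k. k \<in> K \<Longrightarrow> F k \<in> sets borel" "C = {w. \<forall>k\<in>K. w k \<in> F k}"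
      using G_box[OF C] by blast
    have "\<forall>\<^sub>F n in sequentially. \<forall>k\<in>K. \<forall>j\<in>J. (\<tau> ^^ n) k \<noteq> j"
      using J(1) K(1) escape by (simp add: eventually_ball_finite)
    then have "\<forall>\<^sub>F n in sequentially. prob (A \<inter> T n -` C) = prob A * prob C"
    proof (rule eventually_mono)
      fix n assume n: "\<forall>k\<in>K. \<forall>j\<in>J. (\<tau> ^^ n) k \<noteq> j"
      define L where "L = (\<tau> ^^ n) ` K"
      have disj: "J \<inter> L = {}" using n by (auto simp: L_def)
      have iv: "indep_var (PiM J (\<lambda>_. borel)) (\<lambda>w. restrict (\<lambda>i. w i) J) (PiM L (\<lambda>_. borel)) (\<lambda>w. restrict (\<lambda>i. w i) L)"
        by (rule indep_var_restrict[OF coord disj]) auto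
      define X where "X = {y \<in> space (PiM J (\<lambda>_. borel :: real measure)). \<forall>j\<in>J. y j \<in> E j}"
      define Y where "Y = {y \<in> space (PiM L (\<lambda>_. borel :: real measure)). \<forall>k\<in>K. y ((\<tau> ^^ n) k) \<in> F k}"
      have X: "X \<in> sets (PiM J (\<lambda>_. borel))"
        unfolding X_def using J by (intro sets.sets_Collect_finite_All) (auto intro!: sets_Collect_single')
      have Y: "Y \<in> sets (PiM L (\<lambda>_. borel))"
        unfolding Y_def using K by (intro sets.sets_Collect_finite_All) (auto intro!: sets_Collect_single' simp: L_def)
      have eX: "(\<lambda>w. restrict (\<lambda>i. w i) J) -` X \<inter> space P = A"
        by (auto simp: X_def J(3) sp space_PiM)
      have eY: "(\<lambda>w. restrict (\<lambda>i. w i) L) -` Y \<inter> space P = T n -` C"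
        by (auto simp: Y_def K(3) sp space_PiM T_def L_def)
      have "prob ((\<lambda>w. (restrict (\<lambda>i. w i) J, restrict (\<lambda>i. w i) L)) -` (X \<times> Y) \<inter> space P) = prob A * prob (T n -` C)"
        using indep_varD[OF iv X Y] unfolding eX eY .
      also have "(\<lambda>w. (restrict (\<lambda>i. w i) J, restrict (\<lambda>i. w i) L)) -` (X \<times> Y) \<inter> space P = A \<inter> T n -` C"
        using eX eY by auto
      finally show "prob (A \<inter> T n -` C) = prob A * prob C"
        using C G_events by (auto simp: T_pres)
    qed
    then show ?thesis by (rule tendsto_eventually)
  qed
  have BE: "B \<in> events" using B(1) by (simp add: P_def)
  have "prob (B \<inter> C) = prob B * prob C" if C: "C \<in> G" for C
  proof -
    have CE: "C \<in> events" using C G_events by auto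
    have "(\<lambda>n. prob (B \<inter> T n -` C)) \<longlonglongrightarrow> prob B * prob C"
      using G_stable G_events
      by (rule asymptotic_independence_extend)
        (use CE C BE G_sigma in \<open>auto intro: T_events indep simp: T_pres\<close>)
    \<comment> \<open>\<open>B\<close> is fixed by the shift and the shift preserves probability, so
      this sequence is constant and equals its limit.\<close>
    moreover have "prob (B \<inter> T n -` C) = prob (B \<inter> C)" for n
      using T_pres[of "B \<inter> C" n] TB[of n] BE CE by simp
    ultimately show ?thesis by (simp add: LIMSEQ_const_iff)
  qed
  then have "indep_set {B} G"
    using BE G_events by (intro indep_setI) auto
  \<comment> \<open>Independence passes from cylinders to the generated sigma-algebra, which
    contains \<open>B\<close>; its probability then equals its own square.\<close>
  then have "indep_set (sigma_sets (space P) {B}) (sigma_sets (space P) G)"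
    using G_stable by (intro indep_set_sigma_sets) (auto simp: Int_stable_def)
  then have "prob (B \<inter> B) = prob B * prob B"
    by (rule indep_setD) (auto simp: G_sigma BE intro: sigma_sets.Basic)
  then show ?thesis by (simp add: P_def)
qed

section \<open>The stationary field\<close>

lemma funpow_translation:
  fixes x :: "int ^ 'd"
  shows "fst (((\<lambda>(s, y). (s + t, y + x)) ^^ n) (s, y)) = s + int n * t"
    and "snd (((\<lambda>(s, y). (s + t, y + x)) ^^ n) (s, y)) $ i = y $ i + int n * x $ i"
  by (induction n) (auto simp: case_prod_beta algebra_simps)

text \<open>A nonzero translation moves time or some space coordinate by a fixed nonzero integer at
  each iteration, so that coordinate misses the target once \<open>n\<close> exceeds their
  distance.\<close>

lemma translation_escapes:
  fixes x :: "int ^ 'd" and j :: "int \<times> (int ^ 'd)"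
  assumes "(x, t) \<noteq> (0, 0)"
  shows "\<forall>\<^sub>F n in sequentially. ((\<lambda>(s, y). (s + t, y + x)) ^^ n) i \<noteq> j"
proof -
  have escape: "\<forall>\<^sub>F n in sequentially. a + int n * c \<noteq> b" if "c \<noteq> 0" for a b c
  proof (rule eventually_sequentiallyI)
    fix n assume n: "nat \<bar>b - a\<bar> + 1 \<le> n"
    have "\<bar>b - a\<bar> < int n * 1" using n by linarith
    also have "\<dots> \<le> int n * \<bar>c\<bar>" using that by (intro mult_left_mono) auto
    finally show "a + int n * c \<noteq> b" by (auto simp: abs_mult)
  qed
  obtain s y where i: "i = (s, y)" by (cases i)
  show ?thesis
  proof (cases "t = 0")
    case False
    show ?thesis
      using escape[OF False, of s "fst j"] by (rule eventually_mono) (metis i funpow_translation(1))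
  next
    case True
    then obtain l where l: "x $ l \<noteq> 0" using assms by (auto simp: vec_eq_iff)
    show ?thesis
      using escape[OF l, of "y $ l" "snd j $ l"]
      by (rule eventually_mono) (metis i funpow_translation(2))
  qed
qed

lemma measurable_spacetime_component: "(\<lambda>w. w s y) \<in> borel_measurable spacetime_space"
proof -
  have "(\<lambda>w. w s) \<in> measurable spacetime_space state_space"
    unfolding spacetime_space_def by (rule measurable_component_singleton) simp
  from measurable_compose[OF this measurable_state_component] show ?thesis .
qed

lemma measurable_spacetimeI:
  assumes "\<And>s y. (\<lambda>\<omega>. f \<omega> s y) \<in> borel_measurable N"
  shows "f \<in> measurable N spacetime_space"
  unfolding spacetime_space_def state_space_def
  by (intro measurable_PiM_single' assms) (auto simp: space_PiM)

lemma measurable_stateI: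
  assumes "\<And>y. (\<lambda>\<omega>. f \<omega> y) \<in> borel_measurable N"
  shows "f \<in> measurable N state_space"
  unfolding state_space_def
  by (intro measurable_PiM_single' assms) (auto simp: space_PiM)

lemma space_spacetime [simp]: "space spacetime_space = UNIV"
  by (simp add: spacetime_space_def space_PiM)

lemma measurable_st_shift: "st_shift x t \<in> measurable spacetime_space spacetime_space"
  by (rule measurable_spacetimeI) (simp add: st_shift_def measurable_spacetime_component)

text \<open>The noise on its canonical space of configurations; \<open>chi p coordinate\<close> is
  thereby \<open>chi\<close> as a deterministic function of the noise.\<close>

definition coordinate :: "int \<Rightarrow> int ^ 'd \<Rightarrow> (int \<times> (int ^ 'd) \<Rightarrow> real) \<Rightarrow> real" where
  "coordinate t x w = w (t, x)"

lemma chi_coordinate: "chi p coordinate t x (\<lambda>(t, x). \<xi> t x \<omega>) = chi p \<xi> t x \<omega>"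
  by (simp add: chi_def chi_term_def coordinate_def)

text \<open>Asking for measurability up to time \<open>t\<close> only records causality, so that the
  result applies on a product space over the past.\<close>

lemma measurable_chi_term:
  assumes "\<And>s z. s \<le> t \<Longrightarrow> \<xi> s z \<in> borel_measurable N"
  shows "chi_term p \<xi> k t x \<in> borel_measurable N"
proof -
  have "(\<lambda>\<omega>. \<xi> (t - int k) z \<omega>) \<in> borel_measurable N" for z
    by (rule assms) simp
  then show ?thesis
    unfolding chi_term_def[abs_def]
    by (intro borel_measurable_sum borel_measurable_times borel_measurable_const)
qed

lemma measurable_chi:
  assumes "\<And>s z. s \<le> t \<Longrightarrow> \<xi> s z \<in> borel_measurable N"
  shows "chi p \<xi> t x \<in> borel_measurable N"
proof -
  have "(\<lambda>\<omega>. chi_term p \<xi> k t x \<omega>) \<in> borel_measurable N" for k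
    by (rule measurable_chi_term[OF assms])
  then show ?thesis unfolding chi_def[abs_def] by (rule borel_measurable_suminf)
qed

lemma chi_cong:
  assumes "\<And>s z. s \<le> t \<Longrightarrow> \<xi> s z \<omega> = \<eta> s z \<omega>'"
  shows "chi p \<xi> t x \<omega> = chi p \<eta> t x \<omega>'"
  unfolding chi_def chi_term_def using assms by simp

section \<open>Recursion and equivariance of the series\<close>

context finite_range_walk
begin

lemma chi_term_eq: "chi_term p \<xi> k t x \<omega> = walk_sum k (\<lambda>z. \<xi> (t - int k) (x + z) \<omega>)"
proof -
  have "{z. step_pow p k (z - x) \<noteq> 0} = (\<lambda>z. x + z) ` {z. step_pow p k z \<noteq> 0}"
    by (auto simp: image_iff) (metis add_diff_cancel_left' diff_add_cancel add.commute)
  then show ?thesis by (simp add: chi_term_def walk_sum_def sum.reindex mult.commute)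
qed

lemma chi_term_Suc:
  "chi_term p \<xi> (Suc k) (t + 1) x \<omega> = (\<Sum>y | p y \<noteq> 0. p y * chi_term p \<xi> k t (x + y) \<omega>)"
  by (simp add: chi_term_eq walk_sum_Suc add.assoc)

lemma chi_term_0: "chi_term p \<xi> 0 t x \<omega> = \<xi> t x \<omega>"
  by (simp add: chi_term_eq)

text \<open>The term \<open>k = 0\<close> is the fresh noise. By \<open>chi_term_Suc\<close> each
  later term is an average of the previous ones, and summability at all sites lets the finite
  average pass through the series.\<close>

lemma chi_recursion:
  assumes "\<And>t x. summable (\<lambda>k. chi_term p \<xi> k t x \<omega>)"
  shows "chi p \<xi> (t + 1) x \<omega> = avg p (\<lambda>y. chi p \<xi> t y \<omega>) x + \<xi> (t + 1) x \<omega>"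
proof -
  have "chi p \<xi> (t + 1) x \<omega> = (\<Sum>k. chi_term p \<xi> (Suc k) (t + 1) x \<omega>) + \<xi> (t + 1) x \<omega>"
    unfolding chi_def using suminf_split_head[OF assms[of "t + 1" x]] by (simp add: chi_term_0)
  also have "(\<Sum>k. chi_term p \<xi> (Suc k) (t + 1) x \<omega>) = (\<Sum>y | p y \<noteq> 0. \<Sum>k. p y * chi_term p \<xi> k t (x + y) \<omega>)"
    unfolding chi_term_Suc by (rule suminf_sum) (intro summable_mult assms)
  also have "\<dots> = avg p (\<lambda>y. chi p \<xi> t y \<omega>) x"
    by (simp add: avg_eq chi_def suminf_mult[OF assms])
  finally show ?thesis .
qed

text \<open>The kernel depends on differences only, so the two series agree term by term. The
  identity holds for every configuration, including those where the series diverges.\<close>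

lemma chi_coordinate_shift:
  "chi p coordinate s y (\<lambda>i. w (case i of (s, y) \<Rightarrow> (s + t, y + x))) = chi p coordinate (s + t) (y + x) w"
  unfolding chi_def chi_term_eq coordinate_def by (simp add: algebra_simps)

end

section \<open>The field driven by noise when collisions are summable\<close>

locale summable_noise_field = finite_range_walk p + prob_space M
  for p :: "int ^ 'd \<Rightarrow> real" and M :: "'a measure" +
  fixes \<mu> :: "real measure" and \<xi> :: "int \<Rightarrow> int ^ 'd \<Rightarrow> 'a \<Rightarrow> real"
  assumes summable_collision: "summable collision"
    and mu_prob: "prob_space \<mu>" and mu_sets: "sets \<mu> = sets borel"
    and mu_L2: "integrable \<mu> (\<lambda>r. r\<^sup>2)"
    and mu_mean: "(\<integral>r. r \<partial>\<mu>) = 0"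
    and xi_rv: "\<xi> t x \<in> borel_measurable M"
    and xi_indep: "indep_vars (\<lambda>_. borel) (\<lambda>(t, x). \<xi> t x) UNIV"
    and xi_law: "distr M borel (\<xi> t x) = \<mu>"
begin

lemma xi_moments:
  shows "integrable M (\<lambda>\<omega>. (\<xi> t x \<omega>)\<^sup>2)" "expectation (\<xi> t x) = 0"
    "expectation (\<lambda>\<omega>. (\<xi> t x \<omega>)\<^sup>2) = (\<integral>r. r\<^sup>2 \<partial>\<mu>)"
proof -
  show "integrable M (\<lambda>\<omega>. (\<xi> t x \<omega>)\<^sup>2)"
    using mu_L2 unfolding xi_law[of t x, symmetric] by (subst (asm) integrable_distr_eq[OF xi_rv]) auto
  show "expectation (\<xi> t x) = 0"
    using mu_mean unfolding xi_law[of t x, symmetric] by (subst (asm) integral_distr[OF xi_rv]) auto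
  show "expectation (\<lambda>\<omega>. (\<xi> t x \<omega>)\<^sup>2) = (\<integral>r. r\<^sup>2 \<partial>\<mu>)"
    unfolding xi_law[of t x, symmetric] by (subst integral_distr[OF xi_rv]) auto
qed

text \<open>The term is a finite combination of independent centred noises at distinct sites of one
  time row, so the variances add up to a multiple of the collision probability.\<close>

lemma chi_term_moments:
  shows "integrable M (\<lambda>\<omega>. (chi_term p \<xi> k t x \<omega>)\<^sup>2)" "expectation (chi_term p \<xi> k t x) = 0"
    "expectation (\<lambda>\<omega>. (chi_term p \<xi> k t x \<omega>)\<^sup>2) = (\<integral>r. r\<^sup>2 \<partial>\<mu>) * collision k"
proof -
  define A where "A = (\<lambda>z. (t - int k, x + z)) ` {z. step_pow p k z \<noteq> 0}"
  define X where "X i \<omega> = step_pow p k (snd i - x) * \<xi> (fst i) (snd i) \<omega>" for i \<omega>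
  have eq: "chi_term p \<xi> k t x \<omega> = (\<Sum>i\<in>A. X i \<omega>)" for \<omega>
    unfolding A_def by (subst sum.reindex) (auto simp: inj_on_def chi_term_eq walk_sum_def X_def)
  have fin: "finite A" using finite_step_supp by (simp add: A_def)
  have ind: "indep_vars (\<lambda>_. borel) X A"
  proof -
    have "indep_vars (\<lambda>_. borel) (\<lambda>i \<omega>. step_pow p k (snd i - x) * (case i of (t, x) \<Rightarrow> \<xi> t x) \<omega>) UNIV"
      by (rule indep_vars_compose2[OF xi_indep]) simp
    then show ?thesis
      by (auto simp: X_def[abs_def] case_prod_beta intro: indep_vars_subset)
  qed
  have X: "integrable M (\<lambda>\<omega>. (X i \<omega>)\<^sup>2)" "expectation (X i) = 0"
    "expectation (\<lambda>\<omega>. (X i \<omega>)\<^sup>2) = (step_pow p k (snd i - x))\<^sup>2 * (\<integral>r. r\<^sup>2 \<partial>\<mu>)" for i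
    by (simp_all add: X_def[abs_def] power_mult_distrib xi_moments)
  have XI: "integrable M (X i)" for i
  proof (rule square_integrable_imp_integrable[OF _ X(1)])
    show "X i \<in> borel_measurable M"
      unfolding X_def[abs_def] by (rule borel_measurable_times[OF borel_measurable_const xi_rv])
  qed
  show "integrable M (\<lambda>\<omega>. (chi_term p \<xi> k t x \<omega>)\<^sup>2)"
    unfolding eq by (rule indep_sum_second_moment(1)[OF fin ind X(1,2)])
  show "expectation (chi_term p \<xi> k t x) = 0"
    unfolding eq[abs_def] by (simp add: Bochner_Integration.integral_sum XI X(2))
  have "expectation (\<lambda>\<omega>. (chi_term p \<xi> k t x \<omega>)\<^sup>2) = (\<Sum>i\<in>A. (step_pow p k (snd i - x))\<^sup>2 * (\<integral>r. r\<^sup>2 \<partial>\<mu>))"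
    unfolding eq X(3)[symmetric] by (rule indep_sum_second_moment(2)[OF fin ind X(1,2)])
  also have "\<dots> = (\<integral>r. r\<^sup>2 \<partial>\<mu>) * collision k"
    unfolding A_def collision_def
    by (subst sum.reindex) (auto simp: inj_on_def sum_distrib_left mult.commute)
  finally show "expectation (\<lambda>\<omega>. (chi_term p \<xi> k t x \<omega>)\<^sup>2) = (\<integral>r. r\<^sup>2 \<partial>\<mu>) * collision k" .
qed

text \<open>The \<open>k\<close>-th term reads only the noise row at time \<open>t - int k\<close>,
  and distinct rows are disjoint.\<close>

lemma chi_terms_indep: "indep_vars (\<lambda>_. borel) (\<lambda>k. chi_term p \<xi> k t x) UNIV"
proof -
  define K where "K k = {t - int k} \<times> (UNIV :: (int ^ 'd) set)" for k
  have "indep_vars (\<lambda>k. PiM (K k) (\<lambda>_. borel)) (\<lambda>k \<omega>. restrict (\<lambda>i. (case i of (t, x) \<Rightarrow> \<xi> t x) \<omega>) (K k)) UNIV"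
    by (rule indep_vars_restrict[OF xi_indep]) (auto simp: disjoint_family_on_def K_def)
  then have "indep_vars (\<lambda>_. borel) (\<lambda>k \<omega>. walk_sum k (\<lambda>z. restrict (\<lambda>i. (case i of (t, x) \<Rightarrow> \<xi> t x) \<omega>) (K k) (t - int k, x + z))) UNIV"
    by (rule indep_vars_compose2[where Y = "\<lambda>k y. walk_sum k (\<lambda>z. y (t - int k, x + z))"])
      (auto simp: walk_sum_def K_def intro!: borel_measurable_sum measurable_component_singleton)
  then show ?thesis by (simp add: chi_term_eq[abs_def] K_def)
qed

lemma summable_chi_term_moments: "summable (\<lambda>k. expectation (\<lambda>\<omega>. (chi_term p \<xi> k t x \<omega>)\<^sup>2))"
  unfolding chi_term_moments(3) by (intro summable_mult summable_collision)

text \<open>Space-time is countable, so the exceptional null sets of the individual series can be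
  united.\<close>

lemma AE_summable_chi: "AE \<omega> in M. \<forall>t x. summable (\<lambda>k. chi_term p \<xi> k t x \<omega>)"
  unfolding AE_all_countable
  by (intro allI kolmogorov_one_series chi_terms_indep chi_term_moments summable_chi_term_moments)

lemma chi_L2:
  "integrable M (\<lambda>\<omega>. (chi p \<xi> t x \<omega>)\<^sup>2)"
  "(\<lambda>n. expectation (\<lambda>\<omega>. (chi p \<xi> t x \<omega> - (\<Sum>k<n. chi_term p \<xi> k t x \<omega>))\<^sup>2)) \<longlonglongrightarrow> 0"
  unfolding chi_def
  by (intro independent_series_L2 chi_terms_indep chi_term_moments summable_chi_term_moments)+

lemma AE_chi_recursion:
  "AE \<omega> in M. \<forall>t x. chi p \<xi> (t + 1) x \<omega> = avg p (\<lambda>y. chi p \<xi> t y \<omega>) x + \<xi> (t + 1) x \<omega>"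
  using AE_summable_chi by eventually_elim (auto intro!: chi_recursion)

lemma chi_rv: "chi p \<xi> t x \<in> borel_measurable M"
  by (rule measurable_chi) (rule xi_rv)

lemma chi_state_rv: "(\<lambda>\<omega> x. chi p \<xi> t x \<omega>) \<in> measurable M state_space"
  by (rule measurable_stateI) (rule chi_rv)

lemma xi_state_rv: "(\<lambda>\<omega> x. \<xi> t x \<omega>) \<in> measurable M state_space"
  by (rule measurable_stateI) (rule xi_rv)

lemma chi_spacetime_rv: "(\<lambda>\<omega> s y. chi p \<xi> s y \<omega>) \<in> measurable M spacetime_space"
  by (rule measurable_spacetimeI) (rule chi_rv)

definition noise_law :: "(int \<times> (int ^ 'd) \<Rightarrow> real) measure" where
  "noise_law = PiM UNIV (\<lambda>_. \<mu>)"

definition chi_map :: "(int \<times> (int ^ 'd) \<Rightarrow> real) \<Rightarrow> int \<Rightarrow> int ^ 'd \<Rightarrow> real" where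
  "chi_map w s y = chi p coordinate s y w"

lemma sets_noise_law: "sets noise_law = sets (PiM UNIV (\<lambda>_. borel))"
  unfolding noise_law_def by (rule sets_PiM_cong) (simp_all add: mu_sets)

lemma space_noise_law: "space noise_law = UNIV"
  using sets_eq_imp_space_eq[OF sets_noise_law] by (simp add: space_PiM)

lemma coordinate_measurable: "coordinate s y \<in> borel_measurable noise_law"
proof -
  have "coordinate s y \<in> borel_measurable (PiM UNIV (\<lambda>_. borel))"
    unfolding coordinate_def by simp
  then show ?thesis using measurable_cong_sets[OF sets_noise_law refl] by blast
qed

lemma chi_map_measurable: "chi_map \<in> measurable noise_law spacetime_space"
  unfolding chi_map_def by (intro measurable_spacetimeI measurable_chi coordinate_measurable)

lemma noise_rv: "(\<lambda>\<omega> (t, x). \<xi> t x \<omega>) \<in> measurable M noise_law"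
proof -
  have "(\<lambda>\<omega> i. case i of (t, x) \<Rightarrow> \<xi> t x \<omega>) \<in> measurable M (PiM UNIV (\<lambda>_. borel))"
    by (rule measurable_PiM_single') (auto simp: case_prod_beta space_PiM xi_rv)
  then show ?thesis using sets_noise_law measurable_cong_sets[OF refl sets_noise_law] by blast
qed

lemma distr_noise: "distr M noise_law (\<lambda>\<omega> (t, x). \<xi> t x \<omega>) = noise_law"
proof -
  have "distr M (PiM UNIV (\<lambda>_. borel)) (\<lambda>\<omega>. \<lambda>i\<in>UNIV. (case i of (t, x) \<Rightarrow> \<xi> t x) \<omega>)
      = PiM UNIV (\<lambda>i. distr M borel (case i of (t, x) \<Rightarrow> \<xi> t x))"
    using xi_indep by (subst (asm) indep_vars_iff_distr_eq_PiM') (auto simp: case_prod_beta xi_rv)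
  also have "\<dots> = noise_law"
    unfolding noise_law_def by (simp add: case_prod_beta xi_law)
  also have "(\<lambda>\<omega>. \<lambda>i\<in>UNIV. (case i of (t, x) \<Rightarrow> \<xi> t x) \<omega>) = (\<lambda>\<omega> (t, x). \<xi> t x \<omega>)"
    by (auto simp: fun_eq_iff)
  finally have "distr M (PiM UNIV (\<lambda>_. borel)) (\<lambda>\<omega> (t, x). \<xi> t x \<omega>) = noise_law" .
  then show ?thesis
    by (subst distr_cong[OF refl sets_noise_law refl])
qed

lemma distr_xi_row: "distr M state_space (\<lambda>\<omega> x. \<xi> t x \<omega>) = PiM UNIV (\<lambda>_. \<mu>)"
proof -
  have eq: "sets (PiM UNIV (\<lambda>_ :: int ^ 'd. \<mu>)) = sets state_space"
    by (rule sets_iid_state_space[OF mu_sets])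
  have m: "(\<lambda>w x. w (t, x)) \<in> measurable noise_law state_space"
    by (rule measurable_stateI) (rule coordinate_measurable[unfolded coordinate_def[abs_def]])
  have "distr M state_space (\<lambda>\<omega> x. \<xi> t x \<omega>)
      = distr (distr M noise_law (\<lambda>\<omega> (t, x). \<xi> t x \<omega>)) state_space (\<lambda>w x. w (t, x))"
    by (subst distr_distr[OF m noise_rv]) (simp add: comp_def)
  also have "\<dots> = distr noise_law (PiM UNIV (\<lambda>_. \<mu>)) (\<lambda>w x. w (t, x))"
    unfolding distr_noise by (rule distr_cong) (simp_all add: eq)
  also have "\<dots> = PiM UNIV (\<lambda>_. \<mu>)"
    unfolding noise_law_def
    using distr_PiM_reindex[of UNIV "\<lambda>_. \<mu>" "Pair t" UNIV] mu_prob by (simp add: restrict_UNIV inj_on_def)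
  finally show ?thesis .
qed

text \<open>The law of the field is the image of the product measure, which moves invariance and
  ergodicity to the canonical noise space, where translations act.\<close>

lemma chi_law: "distr M spacetime_space (\<lambda>\<omega> s y. chi p \<xi> s y \<omega>) = distr noise_law spacetime_space chi_map"
proof -
  have "(\<lambda>\<omega> s y. chi p \<xi> s y \<omega>) = chi_map \<circ> (\<lambda>\<omega> (t, x). \<xi> t x \<omega>)"
    by (simp add: fun_eq_iff chi_map_def chi_coordinate)
  then have "distr M spacetime_space (\<lambda>\<omega> s y. chi p \<xi> s y \<omega>)
      = distr (distr M noise_law (\<lambda>\<omega> (t, x). \<xi> t x \<omega>)) spacetime_space chi_map"
    by (simp only: distr_distr[OF chi_map_measurable noise_rv])
  then show ?thesis by (simp only: distr_noise)
qed

definition translate :: "int ^ 'd \<Rightarrow> int \<Rightarrow> int \<times> (int ^ 'd) \<Rightarrow> int \<times> (int ^ 'd)" where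
  "translate x t = (\<lambda>(s, y). (s + t, y + x))"

lemma chi_map_translate: "chi_map (\<lambda>i. w (translate x t i)) = st_shift x t (chi_map w)"
  by (simp add: fun_eq_iff chi_map_def st_shift_def translate_def chi_coordinate_shift)

lemma inj_translate: "inj (translate x t)"
  by (auto simp: inj_def translate_def)

text \<open>By equivariance, shifting the field amounts to translating the noise, and an i.i.d. law
  is invariant under translation.\<close>

lemma chi_law_shift:
  "distr (distr M spacetime_space (\<lambda>\<omega> s y. chi p \<xi> s y \<omega>)) spacetime_space (st_shift x t)
    = distr M spacetime_space (\<lambda>\<omega> s y. chi p \<xi> s y \<omega>)"
proof -
  have m: "(\<lambda>w i. w (translate x t i)) \<in> measurable noise_law noise_law"
    unfolding noise_law_def by (rule measurable_iid_reindex)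
  have "distr (distr noise_law spacetime_space chi_map) spacetime_space (st_shift x t)
      = distr noise_law spacetime_space (st_shift x t \<circ> chi_map)"
    by (rule distr_distr[OF measurable_st_shift chi_map_measurable])
  also have "st_shift x t \<circ> chi_map = chi_map \<circ> (\<lambda>w i. w (translate x t i))"
    by (simp add: fun_eq_iff chi_map_translate)
  also have "distr noise_law spacetime_space \<dots> = distr (distr noise_law noise_law (\<lambda>w i. w (translate x t i))) spacetime_space chi_map"
    by (rule distr_distr[OF chi_map_measurable m, symmetric])
  also have "distr noise_law noise_law (\<lambda>w i. w (translate x t i)) = noise_law"
    unfolding noise_law_def by (rule distr_iid_reindex[OF mu_prob inj_translate])
  finally show ?thesis unfolding chi_law .
qed

text \<open>The preimage under \<open>chi_map\<close> of a shift-invariant event is invariant under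
  translation of the noise, hence trivial by \<open>iid_shift_ergodic\<close>.\<close>

lemma chi_invariant_and_ergodic:
  assumes "(x, t) \<noteq> (0, 0)"
  shows "invariant_and_ergodic (distr M spacetime_space (\<lambda>\<omega> s y. chi p \<xi> s y \<omega>)) (st_shift x t)"
proof -
  define Q where "Q = distr M spacetime_space (\<lambda>\<omega> s y. chi p \<xi> s y \<omega>)"
  have Q: "sets Q = sets spacetime_space" "space Q = UNIV" by (simp_all add: Q_def)
  have shiftQ: "distr Q spacetime_space (st_shift x t) = Q"
    unfolding Q_def by (rule chi_law_shift)
  have "distr Q Q (st_shift x t) = distr Q spacetime_space (st_shift x t)"
    by (rule distr_cong) (simp_all only: Q)
  then have "distr Q Q (st_shift x t) = Q" by (simp only: shiftQ)
  moreover have "st_shift x t \<in> measurable Q Q"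
    using measurable_st_shift measurable_cong_sets[OF Q(1) Q(1)] by blast
  moreover have "emeasure Q A = 0 \<or> emeasure Q A = 1"
    if A: "A \<in> sets Q" and inv: "st_shift x t -` A \<inter> space Q = A" for A
  proof -
    interpret P: prob_space noise_law unfolding noise_law_def by (intro prob_space_PiM mu_prob)
    define B where "B = chi_map -` A"
    have BE: "B \<in> sets noise_law"
      using measurable_sets[OF chi_map_measurable, of A] A by (simp add: B_def Q space_noise_law)
    have "measure noise_law B \<in> {0, 1}"
      unfolding noise_law_def
    proof (rule iid_shift_ergodic[OF mu_prob mu_sets inj_translate])
      show "\<forall>\<^sub>F n in sequentially. (translate x t ^^ n) i \<noteq> j" for i j
        unfolding translate_def by (rule translation_escapes[OF assms])
      show "B \<in> sets (PiM UNIV (\<lambda>_. \<mu>))" using BE by (simp add: noise_law_def)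
      have "f \<in> A \<longleftrightarrow> st_shift x t f \<in> A" for f using inv Q(2) by auto
      then show "(\<lambda>i. w (translate x t i)) \<in> B \<longleftrightarrow> w \<in> B" for w
        by (simp add: B_def chi_map_translate)
    qed
    moreover have "emeasure Q A = emeasure noise_law B"
    proof -
      have "A \<in> sets spacetime_space" using A by (simp only: Q(1))
      from emeasure_distr[OF chi_map_measurable this] show ?thesis
        by (simp only: Q_def chi_law B_def space_noise_law Int_UNIV_right)
    qed
    ultimately show ?thesis by (auto simp: P.emeasure_eq_measure)
  qed
  ultimately show ?thesis
    unfolding invariant_and_ergodic_def Q_def[symmetric] by blast
qed

text \<open>The field at time \<open>t\<close> is a function of the noise rows up to
  \<open>t\<close>, which are disjoint from row \<open>t + 1\<close>.\<close>

lemma chi_indep_noise: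
  "indep_var state_space (\<lambda>\<omega> x. chi p \<xi> t x \<omega>) state_space (\<lambda>\<omega> x. \<xi> (t + 1) x \<omega>)"
proof -
  define A where "A = {..t} \<times> (UNIV :: (int ^ 'd) set)"
  define B where "B = {t + 1} \<times> (UNIV :: (int ^ 'd) set)"
  have iv: "indep_var (PiM A (\<lambda>_. borel)) (\<lambda>\<omega>. restrict (\<lambda>i. (case i of (t, x) \<Rightarrow> \<xi> t x) \<omega>) A)
      (PiM B (\<lambda>_. borel)) (\<lambda>\<omega>. restrict (\<lambda>i. (case i of (t, x) \<Rightarrow> \<xi> t x) \<omega>) B)"
    by (rule indep_var_restrict[OF xi_indep]) (auto simp: A_def B_def)
  have mA: "(\<lambda>w x. chi p coordinate t x w) \<in> measurable (PiM A (\<lambda>_. borel)) state_space"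
    by (intro measurable_stateI measurable_chi)
      (auto simp: coordinate_def[abs_def] A_def intro!: measurable_component_singleton)
  have mB: "(\<lambda>w x. w (t + 1, x)) \<in> measurable (PiM B (\<lambda>_. borel)) state_space"
    by (intro measurable_stateI) (auto simp: B_def intro!: measurable_component_singleton)
  have "chi p coordinate t x (restrict (\<lambda>i. (case i of (t, x) \<Rightarrow> \<xi> t x) \<omega>) A) = chi p \<xi> t x \<omega>" for x \<omega>
    by (rule chi_cong) (simp add: coordinate_def A_def)
  then show ?thesis
    using indep_var_compose[OF iv mA mB] by (simp add: comp_def B_def)
qed

lemma chi_row_law_shift:
  "distr M state_space (\<lambda>\<omega> x. chi p \<xi> (t + 1) x \<omega>) = distr M state_space (\<lambda>\<omega> x. chi p \<xi> t x \<omega>)"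
proof -
  define Q where "Q = distr M spacetime_space (\<lambda>\<omega> s y. chi p \<xi> s y \<omega>)"
  have ev: "(\<lambda>f. f s) \<in> measurable spacetime_space state_space" for s
    by (intro measurable_stateI measurable_spacetime_component)
  have row: "distr M state_space (\<lambda>\<omega> x. chi p \<xi> s x \<omega>) = distr Q state_space (\<lambda>f. f s)" for s
    unfolding Q_def by (subst distr_distr[OF ev chi_spacetime_rv]) (simp add: comp_def)
  have "distr Q state_space (\<lambda>f. f t) = distr (distr Q spacetime_space (st_shift 0 1)) state_space (\<lambda>f. f t)"
    unfolding Q_def chi_law_shift ..
  also have "\<dots> = distr Q state_space ((\<lambda>f. f t) \<circ> st_shift 0 1)"
    by (rule distr_distr[OF ev]) (unfold Q_def measurable_distr_eq1, rule measurable_st_shift)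
  also have "(\<lambda>f. f t) \<circ> st_shift 0 1 = (\<lambda>f. f (t + 1))"
    by (simp add: fun_eq_iff st_shift_def)
  finally show ?thesis by (simp add: row)
qed

text \<open>Independence identifies the product law with that of the pair of current field and next
  noise. One update sends this pair almost surely to the field at time \<open>t + 1\<close>, whose
  law is unchanged by \<open>chi_row_law_shift\<close>.\<close>

lemma chi_invariant_distribution:
  "invariant_distribution p \<mu> (distr M state_space (\<lambda>\<omega> x. chi p \<xi> t x \<omega>))"
proof -
  define \<nu> where "\<nu> = distr M state_space (\<lambda>\<omega> x. chi p \<xi> t x \<omega>)"
  define pair where "pair \<omega> = ((\<lambda>x. chi p \<xi> t x \<omega>), (\<lambda>x. \<xi> (t + 1) x \<omega>))" for \<omega>
  have pair: "pair \<in> measurable M (state_space \<Otimes>\<^sub>M state_space)"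
    unfolding pair_def by (intro measurable_Pair chi_state_rv xi_state_rv)
  have "\<nu> \<Otimes>\<^sub>M distr M state_space (\<lambda>\<omega> x. \<xi> (t + 1) x \<omega>) = distr M (state_space \<Otimes>\<^sub>M state_space) pair"
    using chi_indep_noise[of t] unfolding \<nu>_def pair_def[abs_def] indep_var_distribution_eq by blast
  then have law: "\<nu> \<Otimes>\<^sub>M PiM UNIV (\<lambda>_. \<mu>) = distr M (state_space \<Otimes>\<^sub>M state_space) pair"
    by (simp only: distr_xi_row)
  have "distr (\<nu> \<Otimes>\<^sub>M PiM UNIV (\<lambda>_. \<mu>)) state_space (\<lambda>(h, e). height_step p h e)
      = distr M state_space ((\<lambda>(h, e). height_step p h e) \<circ> pair)"
    unfolding law by (rule distr_distr[OF measurable_height_step pair])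
  also have "\<dots> = distr M state_space (\<lambda>\<omega> x. chi p \<xi> (t + 1) x \<omega>)"
  proof (rule distr_cong_AE)
    show "AE \<omega> in M. ((\<lambda>(h, e). height_step p h e) \<circ> pair) \<omega> = (\<lambda>x. chi p \<xi> (t + 1) x \<omega>)"
      using AE_chi_recursion by eventually_elim (simp add: pair_def height_step_def fun_eq_iff)
  qed (rule refl measurable_comp[OF pair measurable_height_step] chi_state_rv)+
  also have "\<dots> = \<nu>" unfolding \<nu>_def by (rule chi_row_law_shift)
  finally show ?thesis
    unfolding invariant_distribution_def \<nu>_def[symmetric]
    using prob_space_distr[OF chi_state_rv[of t], folded \<nu>_def] sets_distr[of M state_space, folded \<nu>_def]
    by (simp only: \<nu>_def sets_distr)
qed

end

section \<open>From a bounded range kernel to the theorem\<close>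

lemma finite_range_walk_of_bounded:
  fixes p :: "int ^ 'd \<Rightarrow> real"
  assumes p_range: "\<And>x. 0 \<le> p x"
    and p_sum: "(p has_sum 1) UNIV"
    and p_bdd: "\<exists>R. \<forall>x. lnorm x > R \<longrightarrow> p x = 0"
  shows "finite_range_walk p"
proof
  obtain R where R: "\<And>x. lnorm x > R \<Longrightarrow> p x = 0" using p_bdd by blast
  define L where "L = max 1 R"
  have "{y. p y \<noteq> 0} \<subseteq> {z. \<forall>i. \<bar>real_of_int (z $ i) - 0\<bar> \<le> L}"
  proof (intro subsetI CollectI allI)
    fix z i assume "z \<in> {y. p y \<noteq> 0}"
    then have "p z \<noteq> 0" by simp
    then have "lnorm z \<le> R" using R not_le by blast
    moreover have "\<bar>real_of_int (z $ i)\<bar> \<le> lnorm z"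
      unfolding lnorm_def
      by (rule real_le_rsqrt) (simp add: member_le_sum[of i UNIV "\<lambda>i. (real_of_int (z $ i))\<^sup>2"])
    ultimately show "\<bar>real_of_int (z $ i) - 0\<bar> \<le> L" by (simp add: L_def)
  qed
  moreover have "finite {z :: int ^ 'd. \<forall>i. \<bar>real_of_int (z $ i) - 0\<bar> \<le> L}"
    by (rule card_int_vec_box) (simp add: L_def)
  ultimately show fin: "finite {y. p y \<noteq> 0}" by (rule finite_subset)
  \<comment> \<open>Since \<open>p\<close> vanishes off its finite support, the unordered sum over
    the lattice becomes a finite sum.\<close>
  have "(p has_sum 1) {y. p y \<noteq> 0}"
    using p_sum by (subst has_sum_cong_neutral[where T = UNIV and g = p]) auto
  then show "(\<Sum>y | p y \<noteq> 0. p y) = 1"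
    using has_sum_finite[OF fin, of p] has_sum_unique by blast
qed (rule p_range)

text \<open>Positive variance excludes noise that vanishes almost surely, for which the point mass
  at the zero configuration is invariant. The second half concerns any probability space carrying
  such noise.\<close>

theorem theorem2p7:
  fixes p :: "int ^ 'd \<Rightarrow> real" and \<mu> :: "real measure"
  assumes p_range: "\<And>x. 0 \<le> p x \<and> p x < 1"
    and p_sum: "(p has_sum 1) UNIV"
    and p_bdd: "\<exists>R. \<forall>x. lnorm x > R \<longrightarrow> p x = 0"
    and p_aper: "strongly_aperiodic p"
    and mu_prob: "prob_space \<mu>" and mu_sets: "sets \<mu> = sets borel"
    and mu_L2: "integrable \<mu> (\<lambda>r. r\<^sup>2)"
    and mu_mean: "(\<integral>r. r \<partial>\<mu>) = 0"
    and mu_var: "(\<integral>r. r\<^sup>2 \<partial>\<mu>) > 0"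
  shows
    "(CARD('d) \<le> 2 \<longrightarrow> (\<nexists>\<nu>. invariant_distribution p \<mu> \<nu>))
   \<and> (CARD('d) \<ge> 3 \<longrightarrow>
       (\<forall>(M :: 'a measure) (\<xi> :: int \<Rightarrow> int ^ 'd \<Rightarrow> 'a \<Rightarrow> real).
          prob_space M
          \<longrightarrow> (\<forall>t x. \<xi> t x \<in> borel_measurable M)
          \<longrightarrow> prob_space.indep_vars M (\<lambda>_. borel) (\<lambda>(t, x). \<xi> t x) UNIV
          \<longrightarrow> (\<forall>t x. distr M borel (\<xi> t x) = \<mu>)
          \<longrightarrow>
            (AE \<omega> in M. \<forall>t x. summable (\<lambda>k. chi_term p \<xi> k t x \<omega>))
          \<and> (\<forall>t x. chi p \<xi> t x \<in> borel_measurable M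
                  \<and> integrable M (\<lambda>\<omega>. (chi p \<xi> t x \<omega>)\<^sup>2)
                  \<and> (\<lambda>n. \<integral>\<omega>. (chi p \<xi> t x \<omega> - (\<Sum>k<n. chi_term p \<xi> k t x \<omega>))\<^sup>2 \<partial>M)
                      \<longlonglongrightarrow> 0)
          \<and> (AE \<omega> in M. \<forall>t x. chi p \<xi> (t + 1) x \<omega>
                 = avg p (\<lambda>y. chi p \<xi> t y \<omega>) x + \<xi> (t + 1) x \<omega>)
          \<and> (\<forall>t. invariant_distribution p \<mu> (distr M state_space (\<lambda>\<omega> x. chi p \<xi> t x \<omega>))
                 \<and> prob_space.indep_var M state_space (\<lambda>\<omega> x. chi p \<xi> t x \<omega>)
                      state_space (\<lambda>\<omega> x. \<xi> (t + 1) x \<omega>))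
          \<and> (\<forall>x t. (x, t) \<noteq> (0, 0) \<longrightarrow>
                invariant_and_ergodic
                  (distr M spacetime_space (\<lambda>\<omega> s y. chi p \<xi> s y \<omega>)) (st_shift x t))))"
proof (rule conjI, goal_cases)
  interpret finite_range_walk p
    using p_range p_sum p_bdd by (intro finite_range_walk_of_bounded) auto
  case 1
  show ?case
    using no_invariant_distribution[OF _ mu_prob mu_sets mu_L2 mu_mean mu_var] by blast
  case 2
  show ?case
  proof (intro impI allI, goal_cases)
    case (1 M \<xi>)
    interpret M: prob_space M by (rule 1(2))
    interpret summable_noise_field p M \<mu> \<xi>
      by (intro summable_noise_field.intro summable_noise_field_axioms.intro finite_range_walk_axioms
          collision_summable p_aper mu_prob mu_sets mu_L2 mu_mean 1 1(3,5)[rule_format])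
    show ?case
      by (intro conjI allI impI AE_summable_chi chi_rv chi_L2 AE_chi_recursion chi_invariant_distribution
          chi_indep_noise chi_invariant_and_ergodic)
  qed
qed

end
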